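(* Let $P$ be a binary matrix (pattern). The class $\mathrm{Av}(P)$ is row-bounded if and only if $P$ does not contain any of $Q_1,Q_2,Q_3,Q_4$ as an interval minor, where $Q_1,\dots,Q_4\in\{0,1\}^{3\times3}$ are the permutation matrices with $\mathrm{supp}(Q_1)=\{(1,2),(2,1),(3,3)\}$, $\mathrm{supp}(Q_2)=\{(1,2),(2,3),(3,1)\}$, $\mathrm{supp}(Q_3)=\{(1,1),(2,3),(3,2)\}$, $\mathrm{supp}(Q_4)=\{(1,3),(2,1),(3,2)\}$.
   Context: All matrices are binary. For $M\in\{0,1\}^{m\times n}$, rows are numbered $1,\dots,m$ top to bottom and columns $1,\dots,n$ left to right; $(i,j)$ is the entry in row $i$, column $j$; it is a 1-entry if $M(i,j)=1$ and a 0-entry otherwise; $\mathrm{supp}(M)$ is the set of 1-entries. For integers, $[a,b]=\{a,\dots,b\}$, $(a,b]=[a+1,b]$, $[n]=[1,n]$, and $M[R\times C]$ denotes the submatrix on row set $R$ and column set $C$. A pattern $P\in\{0,1\}^{k\times\ell}$ is an interval minor of $M\in\{0,1\}^{m\times n}$ (written $P\preccurlyeq M$; $M$ contains $P$) if there are integers $0=r_0<r_1<\dots<r_k=m$ and $0=c_0<c_1<\dots<c_\ell=n$ such that for each 1-entry $(i,j)$ of $P$ the submatrix $M[(r_{i-1},r_i]\times(c_{j-1},c_j]]$ contains a 1-entry; otherwise $M$ avoids $P$. $\mathrm{Av}(P)$ is the set of all binary matrices avoiding $P$. A matrix $M$ in a set $\mathcal C$ of matrices is critical for $\mathcal C$ if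 changing any single 0-entry of $M$ into a 1-entry yields a matrix not in $\mathcal C$. A horizontal 0-run of $M$ is a maximal set of consecutive 0-entries within one row; the complexity of a row is the number of horizontal 0-runs in it. The row-complexity of $\mathcal C$ is the supremum, over all matrices critical for $\mathcal C$, of the maximum complexity of a row of the matrix; $\mathcal C$ is row-bounded if this is finite. *)

theory Defs
  imports Main
begin

text \<open>A binary matrix is represented as a triple (m, n, A): m rows, n columns,
  and A i j = True iff (i,j) is a 1-entry (rows/columns are 1-indexed).\<close>
type_synonym bmat = "nat \<times> nat \<times> (nat \<Rightarrow> nat \<Rightarrow> bool)"

definition is_mat :: "bmat \<Rightarrow> bool" where
  "is_mat M = (case M of (m, n, A) \<Rightarrow>
      1 \<le> m \<and> 1 \<le> n \<and> (\<forall>i j. A i j \<longrightarrow> 1 \<le> i \<and> i \<le> m \<and> 1 \<le> j \<and> j \<le> n))"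

definition contains :: "bmat \<Rightarrow> bmat \<Rightarrow> bool" where
  "contains P M = (case P of (k, l, B) \<Rightarrow> case M of (m, n, A) \<Rightarrow>
     (\<exists>r c :: nat \<Rightarrow> nat.
        r 0 = 0 \<and> r k = m \<and> (\<forall>i<k. r i < r (Suc i)) \<and>
        c 0 = 0 \<and> c l = n \<and> (\<forall>j<l. c j < c (Suc j)) \<and>
        (\<forall>i\<in>{1..k}. \<forall>j\<in>{1..l}. B i j \<longrightarrow>
           (\<exists>a\<in>{r (i - 1)<..r i}. \<exists>b\<in>{c (j - 1)<..c j}. A a b))))"

definition Av :: "bmat \<Rightarrow> bmat set" where
  "Av P = {M. is_mat M \<and> \<not> contains P M}"

definition critical :: "bmat set \<Rightarrow> bmat \<Rightarrow> bool" where
  "critical C M = (M \<in> C \<and> (case M of (m, n, A) \<Rightarrow>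
     (\<forall>i j. 1 \<le> i \<and> i \<le> m \<and> 1 \<le> j \<and> j \<le> n \<and> \<not> A i j \<longrightarrow>
        (m, n, A(i := (A i)(j := True))) \<notin> C)))"

text \<open>Number of horizontal 0-runs in row i (counted via their left endpoints).\<close>
definition row_complexity :: "bmat \<Rightarrow> nat \<Rightarrow> nat" where
  "row_complexity M i = (case M of (m, n, A) \<Rightarrow>
     card {j \<in> {1..n}. \<not> A i j \<and> (j = 1 \<or> A i (j - 1))})"

definition row_bounded :: "bmat set \<Rightarrow> bool" where
  "row_bounded C = (\<exists>b::nat. \<forall>M. critical C M \<longrightarrow>
      (\<forall>i\<in>{1..fst M}. row_complexity M i \<le> b))"

definition perm3 :: "(nat \<times> nat) set \<Rightarrow> bmat" where
  "perm3 S = (3, 3, \<lambda>i j. (i, j) \<in> S)"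

definition Q1 :: bmat where "Q1 = perm3 {(1,2),(2,1),(3,3)}"
definition Q2 :: bmat where "Q2 = perm3 {(1,2),(2,3),(3,1)}"
definition Q3 :: bmat where "Q3 = perm3 {(1,1),(2,3),(3,2)}"
definition Q4 :: bmat where "Q4 = perm3 {(1,3),(2,1),(3,2)}"

end

theory Submission
  imports Defs
begin

text \<open>The pattern avoids all four \<open>Q\<close>'s iff any three of its 1-entries in distinct rows and columns are
  monotone.

  If some triple is not, we may assume by reflection that it has the order type 213. An antidiagonal
  of all-one blocks, below a row of ones with one hole per block and framed by full rows and columns,
  then avoids the pattern, while filling any hole creates it; these holes survive in every critical
  matrix above.

  Conversely, suppose that a row of a critical matrix has many 0-runs. By the pigeonhole principle, many
  of them are blocked by copies of the pattern in which the new 1-entry plays the role of the same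
  entry \<open>(a, b)\<close>. The ones separating the runs confine the column block \<open>b\<close> of each copy to a gap of
  the row. One glues the left part of an early copy to the right part of a late one, placing \<open>(a, b)\<close>,
  and other entries of row \<open>a\<close> if necessary, on separating ones; this is a copy of the pattern
  without any new entry. Monotonicity of triples restricts the four quadrants around \<open>(a, b)\<close> enough
  for the rows of the two copies to be compatible, except for patterns with two nonempty rows, which
  need more than two copies.\<close>

subsection \<open>Cuts and reflections\<close>

text \<open>The columns of two copies are easily cut apart, since ones of row \<open>i\<close> lie
  between them. The rows are the obstacle: the copies cut them independently, and an entry can be
  inherited only if its new row block encloses its old one. Merging two systems of row cuts can be
  made to enclose both old blocks at one row, and row \<open>a\<close> separates two such merges. So
  everything depends on which rows must serve both copies. A triple through \<open>(a, b)\<close>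
  shows that two nonempty quadrants on the same side of row \<open>a\<close> share one row; further
  entries of row \<open>a\<close> and of column \<open>b\<close> cause the remaining distinctions.
  The bound arises as follows: \<open>l + 2\<close> copies leave a separating one for each column
  that row \<open>a\<close> may occupy; \<open>2 * (l * (l + 1))\<close> comes from patterns with
  two nonempty rows, with \<open>l * (l + 1)\<close> for either side of an extremal copy; the factor
  \<open>k * l\<close> counts the roles of the new one.\<close>

definition cuts :: "nat \<Rightarrow> nat \<Rightarrow> (nat \<Rightarrow> nat) \<Rightarrow> bool" where
  "cuts k m r \<longleftrightarrow> r 0 = 0 \<and> r k = m \<and> (\<forall>t<k. r t < r (Suc t))"

definition hit :: "(nat \<Rightarrow> nat \<Rightarrow> bool) \<Rightarrow> (nat \<Rightarrow> nat) \<Rightarrow> (nat \<Rightarrow> nat) \<Rightarrow> nat \<Rightarrow> nat \<Rightarrow> bool" where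
  "hit A r c x y \<longleftrightarrow> (\<exists>p q. r (x - 1) < p \<and> p \<le> r x \<and> c (y - 1) < q \<and> q \<le> c y \<and> A p q)"

lemma is_mat_iff:
  "is_mat (m, n, A) \<longleftrightarrow> 1 \<le> m \<and> 1 \<le> n \<and> (\<forall>i j. A i j \<longrightarrow> 1 \<le> i \<and> i \<le> m \<and> 1 \<le> j \<and> j \<le> n)"
  by (simp add: is_mat_def)

lemma contains_iff:
  "contains (k, l, B) (m, n, A) \<longleftrightarrow>
     (\<exists>r c. cuts k m r \<and> cuts l n c \<and>
        (\<forall>x y. 1 \<le> x \<longrightarrow> x \<le> k \<longrightarrow> 1 \<le> y \<longrightarrow> y \<le> l \<longrightarrow> B x y \<longrightarrow> hit A r c x y))"
proof -
  have "(\<exists>p\<in>{r (x - 1)<..r x}. \<exists>q\<in>{c (y - 1)<..c y}. A p q) \<longleftrightarrow> hit A r c x y" for r c x y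
    unfolding hit_def greaterThanAtMost_iff Bex_def by blast
  then show ?thesis
    unfolding contains_def cuts_def prod.case Ball_def atLeastAtMost_iff by (simp only: imp_conjL conj_assoc all_simps)
qed

lemma containsI:
  assumes "cuts k m r" "cuts l n c"
    and "\<And>x y. 1 \<le> x \<Longrightarrow> x \<le> k \<Longrightarrow> 1 \<le> y \<Longrightarrow> y \<le> l \<Longrightarrow> B x y \<Longrightarrow> hit A r c x y"
  shows "contains (k, l, B) (m, n, A)"
  unfolding contains_iff
  by (rule exI[of _ r], rule exI[of _ c]) (use assms in blast)

lemma hitI: "r (x - 1) < p \<Longrightarrow> p \<le> r x \<Longrightarrow> c (y - 1) < q \<Longrightarrow> q \<le> c y \<Longrightarrow> A p q \<Longrightarrow> hit A r c x y"
  unfolding hit_def by blast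

lemma hit_mono:
  assumes "hit A r c x y" "r' (x - 1) \<le> r (x - 1)" "r x \<le> r' x" "c' (y - 1) \<le> c (y - 1)" "c y \<le> c' y"
  shows "hit A r' c' x y"
proof -
  obtain p q where "r (x - 1) < p" "p \<le> r x" "c (y - 1) < q" "q \<le> c y" "A p q"
    using assms(1) unfolding hit_def by blast
  then show ?thesis by (intro hitI[of _ _ p _ _ q]) (use assms in linarith)+
qed

lemma contains_mono:
  assumes "contains P (m, n, A)" and sub: "\<And>p q. A p q \<Longrightarrow> A' p q"
  shows "contains P (m, n, A')"
proof (cases P)
  case (fields k l B)
  have "hit A' r c x y" if "hit A r c x y" for r c x y
    using that sub unfolding hit_def by blast
  then show ?thesis
    using assms(1) unfolding fields contains_iff by meson
qed

lemma cuts_gap: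
  assumes "cuts k m r" "s \<le> t" "t \<le> k"
  shows "r s + (t - s) \<le> r t"
  using assms(2,3)
proof (induction t rule: dec_induct)
  case (step t)
  have "r t < r (Suc t)" using assms(1) step.prems by (simp add: cuts_def)
  then show ?case using step by simp
qed simp

lemma cuts_mono: "cuts k m r \<Longrightarrow> s \<le> t \<Longrightarrow> t \<le> k \<Longrightarrow> r s \<le> r t"
  using cuts_gap[of k m r s t] by linarith

lemma cuts_strict: "cuts k m r \<Longrightarrow> s < t \<Longrightarrow> t \<le> k \<Longrightarrow> r s < r t"
  using cuts_gap[of k m r s t] by simp

lemma cuts_0: "cuts k m r \<Longrightarrow> r 0 = 0" and cuts_top: "cuts k m r \<Longrightarrow> r k = m"
  by (simp_all add: cuts_def)

lemma cuts_ge: "cuts k m r \<Longrightarrow> t \<le> k \<Longrightarrow> t \<le> r t"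
  using cuts_gap[of k m r 0 t] by (simp add: cuts_0)

lemma cuts_le: "cuts k m r \<Longrightarrow> t \<le> k \<Longrightarrow> r t + (k - t) \<le> m"
  using cuts_gap[of k m r t k] by (simp add: cuts_top)

lemma cuts_flip:
  assumes "cuts k m r"
  shows "cuts k m (\<lambda>t. m - r (k - t))"
  unfolding cuts_def
proof (intro conjI allI impI)
  fix t assume t: "t < k"
  have "r (k - Suc t) < r (k - t)" using t cuts_strict[OF assms, of "k - Suc t" "k - t"] by simp
  moreover have "r (k - t) \<le> m" using cuts_le[OF assms, of "k - t"] by simp
  ultimately show "m - r (k - t) < m - r (k - Suc t)" by linarith
qed (simp_all add: cuts_0[OF assms] cuts_top[OF assms])

lemma cuts_splice:
  assumes "cuts k m r" "cuts k m r'" "1 \<le> p" "p \<le> k" "r (p - 1) < r' p"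
  shows "cuts k m (\<lambda>t. if t < p then r t else r' t)"
  unfolding cuts_def
proof (intro conjI allI impI)
  fix t assume t: "t < k"
  have "r t < r (Suc t)" "r' t < r' (Suc t)"
    using assms(1,2) t unfolding cuts_def by blast+
  moreover have "Suc t = p \<Longrightarrow> r t < r' (Suc t)"
    using assms(5) by auto
  ultimately show "(if t < p then r t else r' t) < (if Suc t < p then r (Suc t) else r' (Suc t))"
    by (cases "t < p"; cases "Suc t < p"; cases "Suc t = p") simp_all
qed (use assms(3,4) cuts_0[OF assms(1)] cuts_top[OF assms(2)] in simp_all)

section \<open>Reflections in a vertical and in a horizontal axis\<close>

definition hflip :: "bmat \<Rightarrow> bmat" where
  "hflip M = (case M of (m, n, A) \<Rightarrow> (m, n, \<lambda>i j. A i (n + 1 - j)))"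

definition vflip :: "bmat \<Rightarrow> bmat" where
  "vflip M = (case M of (m, n, A) \<Rightarrow> (m, n, \<lambda>i j. A (m + 1 - i) j))"

lemma hit_hflip:
  assumes "hit A r c x y" "cuts l n c" "1 \<le> y" "y \<le> l"
  shows "hit (\<lambda>p q. A p (n + 1 - q)) r (\<lambda>t. n - c (l - t)) x (l + 1 - y)"
proof -
  obtain p q where pq: "r (x - 1) < p" "p \<le> r x" "c (y - 1) < q" "q \<le> c y" "A p q"
    using assms(1) unfolding hit_def by blast
  have "c y \<le> n" using cuts_le[OF assms(2,4)] by simp
  have e: "l - (l + 1 - y - 1) = y" "l - (l + 1 - y) = y - 1" "n + 1 - (n + 1 - q) = q"
    using assms \<open>c y \<le> n\<close> pq by auto
  show ?thesis
    by (rule hitI[of _ _ p _ _ "n + 1 - q"]) (use pq e \<open>c y \<le> n\<close> in auto)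
qed

lemma hit_vflip:
  assumes "hit A r c x y" "cuts k m r" "1 \<le> x" "x \<le> k"
  shows "hit (\<lambda>p q. A (m + 1 - p) q) (\<lambda>t. m - r (k - t)) c (k + 1 - x) y"
proof -
  obtain p q where pq: "r (x - 1) < p" "p \<le> r x" "c (y - 1) < q" "q \<le> c y" "A p q"
    using assms(1) unfolding hit_def by blast
  have "r x \<le> m" using cuts_le[OF assms(2,4)] by simp
  have e: "k - (k + 1 - x - 1) = x" "k - (k + 1 - x) = x - 1" "m + 1 - (m + 1 - p) = p"
    using assms \<open>r x \<le> m\<close> pq by auto
  show ?thesis
    by (rule hitI[of _ _ "m + 1 - p" _ _ q]) (use pq e \<open>r x \<le> m\<close> in auto)
qed

lemma contains_hflip:
  assumes "contains P M"
  shows "contains (hflip P) (hflip M)"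
proof -
  obtain k l B m n A where PM: "P = (k, l, B)" "M = (m, n, A)" by (metis prod_cases3)
  obtain r c where rc: "cuts k m r" "cuts l n c"
    "\<And>x y. 1 \<le> x \<Longrightarrow> x \<le> k \<Longrightarrow> 1 \<le> y \<Longrightarrow> y \<le> l \<Longrightarrow> B x y \<Longrightarrow> hit A r c x y"
    using assms unfolding PM contains_iff by blast
  show ?thesis unfolding PM hflip_def prod.case
  proof (rule containsI[OF rc(1) cuts_flip[OF rc(2)]])
    fix x y assume xy: "1 \<le> x" "x \<le> k" "1 \<le> y" "y \<le> l" "B x (l + 1 - y)"
    have "hit A r c x (l + 1 - y)" by (rule rc(3)) (use xy in auto)
    from hit_hflip[OF this rc(2)]
    show "hit (\<lambda>i j. A i (n + 1 - j)) r (\<lambda>t. n - c (l - t)) x y" using xy by simp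
  qed
qed

lemma contains_vflip:
  assumes "contains P M"
  shows "contains (vflip P) (vflip M)"
proof -
  obtain k l B m n A where PM: "P = (k, l, B)" "M = (m, n, A)" by (metis prod_cases3)
  obtain r c where rc: "cuts k m r" "cuts l n c"
    "\<And>x y. 1 \<le> x \<Longrightarrow> x \<le> k \<Longrightarrow> 1 \<le> y \<Longrightarrow> y \<le> l \<Longrightarrow> B x y \<Longrightarrow> hit A r c x y"
    using assms unfolding PM contains_iff by blast
  show ?thesis unfolding PM vflip_def prod.case
  proof (rule containsI[OF cuts_flip[OF rc(1)] rc(2)])
    fix x y assume xy: "1 \<le> x" "x \<le> k" "1 \<le> y" "y \<le> l" "B (k + 1 - x) y"
    have "hit A r c (k + 1 - x) y" by (rule rc(3)) (use xy in auto)
    from hit_vflip[OF this rc(1)]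
    show "hit (\<lambda>i j. A (m + 1 - i) j) (\<lambda>t. m - r (k - t)) c x y" using xy by simp
  qed
qed

lemma is_mat_hflip: "is_mat M \<Longrightarrow> is_mat (hflip M)"
proof (cases M)
  case (fields m n A)
  assume "is_mat M"
  then have A: "1 \<le> m" "1 \<le> n" "\<And>i j. A i j \<Longrightarrow> 1 \<le> i \<and> i \<le> m \<and> 1 \<le> j \<and> j \<le> n"
    unfolding fields is_mat_iff by blast+
  have "1 \<le> i \<and> i \<le> m \<and> 1 \<le> j \<and> j \<le> n" if "A i (n + 1 - j)" for i j
    using A(3)[OF that] A(3)[of i "n + 1"] that by (cases "j = 0") auto
  then show ?thesis using A(1,2) unfolding fields hflip_def prod.case is_mat_iff by blast
qed

lemma is_mat_vflip: "is_mat M \<Longrightarrow> is_mat (vflip M)"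
proof (cases M)
  case (fields m n A)
  assume "is_mat M"
  then have A: "1 \<le> m" "1 \<le> n" "\<And>i j. A i j \<Longrightarrow> 1 \<le> i \<and> i \<le> m \<and> 1 \<le> j \<and> j \<le> n"
    unfolding fields is_mat_iff by blast+
  have "1 \<le> i \<and> i \<le> m \<and> 1 \<le> j \<and> j \<le> n" if "A (m + 1 - i) j" for i j
    using A(3)[OF that] A(3)[of "m + 1" j] that by (cases "i = 0") auto
  then show ?thesis using A(1,2) unfolding fields vflip_def prod.case is_mat_iff by blast
qed

text \<open>Truncated subtraction restores \<open>j\<close> only up to \<open>j = n + 1\<close>.
  Beyond that both functions are False, because \<open>is_mat\<close> confines the ones to the
  range; so they agree at every argument.\<close>

lemma hflip_hflip: "is_mat M \<Longrightarrow> hflip (hflip M) = M"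
proof (cases M)
  case (fields m n A)
  assume "is_mat M"
  then have "A i (n + 1 - (n + 1 - j)) = A i j" for i j
    unfolding fields is_mat_iff
    by (cases "j \<le> n + 1") (simp, force)
  then show ?thesis by (simp add: fields hflip_def)
qed

lemma vflip_vflip: "is_mat M \<Longrightarrow> vflip (vflip M) = M"
proof (cases M)
  case (fields m n A)
  assume "is_mat M"
  then have "A (m + 1 - (m + 1 - i)) j = A i j" for i j
    unfolding fields is_mat_iff
    by (cases "i \<le> m + 1") (simp, force)
  then show ?thesis unfolding fields vflip_def prod.case by (intro arg_cong2[of _ _ _ _ Pair] refl ext) blast
qed

lemma contains_hflip_iff: "is_mat P \<Longrightarrow> is_mat M \<Longrightarrow> contains (hflip P) (hflip M) \<longleftrightarrow> contains P M"
  by (metis contains_hflip hflip_hflip)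

lemma contains_vflip_iff: "is_mat P \<Longrightarrow> is_mat M \<Longrightarrow> contains (vflip P) (vflip M) \<longleftrightarrow> contains P M"
  by (metis contains_vflip vflip_vflip)

section \<open>Monotone triples and the four forbidden patterns\<close>

definition monotone_triples :: "(nat \<Rightarrow> nat \<Rightarrow> bool) \<Rightarrow> bool" where
  "monotone_triples B \<longleftrightarrow> (\<forall>x1 x2 x3 y1 y2 y3. B x1 y1 \<longrightarrow> B x2 y2 \<longrightarrow> B x3 y3 \<longrightarrow>
     x1 < x2 \<longrightarrow> x2 < x3 \<longrightarrow> y1 \<noteq> y2 \<longrightarrow> y2 \<noteq> y3 \<longrightarrow> y1 \<noteq> y3 \<longrightarrow>
     y1 < y2 \<and> y2 < y3 \<or> y3 < y2 \<and> y2 < y1)"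

lemma monotone_triples_hflip:
  assumes "is_mat (k, l, B)" "monotone_triples B"
  shows "monotone_triples (\<lambda>x y. B x (l + 1 - y))"
  unfolding monotone_triples_def
proof (intro allI impI)
  fix x1 x2 x3 y1 y2 y3
  assume h: "B x1 (l + 1 - y1)" "B x2 (l + 1 - y2)" "B x3 (l + 1 - y3)"
    "x1 < x2" "x2 < x3" "y1 \<noteq> y2" "y2 \<noteq> y3" "y1 \<noteq> y3"
  have "1 \<le> l + 1 - y1" "1 \<le> l + 1 - y2" "1 \<le> l + 1 - y3"
    using h assms(1) unfolding is_mat_iff by blast+
  moreover note assms(2)[unfolded monotone_triples_def, rule_format, OF h(1-5)]
  ultimately show "y1 < y2 \<and> y2 < y3 \<or> y3 < y2 \<and> y2 < y1"
    using h(6-8) by linarith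
qed

lemma monotone_triples_vflip:
  assumes "is_mat (k, l, B)" "monotone_triples B"
  shows "monotone_triples (\<lambda>x y. B (k + 1 - x) y)"
  unfolding monotone_triples_def
proof (intro allI impI)
  fix x1 x2 x3 y1 y2 y3
  assume h: "B (k + 1 - x1) y1" "B (k + 1 - x2) y2" "B (k + 1 - x3) y3"
    "x1 < x2" "x2 < x3" "y1 \<noteq> y2" "y2 \<noteq> y3" "y1 \<noteq> y3"
  have "1 \<le> k + 1 - x1" "1 \<le> k + 1 - x2" "1 \<le> k + 1 - x3"
    using h assms(1) unfolding is_mat_iff by blast+
  then have "k + 1 - x3 < k + 1 - x2" "k + 1 - x2 < k + 1 - x1" using h by linarith+
  then show "y1 < y2 \<and> y2 < y3 \<or> y3 < y2 \<and> y2 < y1"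
    using assms(2)[unfolded monotone_triples_def, rule_format, OF h(3,2,1)] h(6-8) by linarith
qed

text \<open>Here \<open>u1 < u2 < u3\<close> are the three columns in sorted order, so column
  \<open>j\<close> of the permutation stands for the \<open>j\<close>-th smallest of them. Cutting
  right after \<open>x1\<close>, \<open>x2\<close> and after \<open>u1\<close>, \<open>u2\<close>
  separates the three ones.\<close>

lemma contains_perm3:
  assumes "is_mat (k, l, B)" "B x1 y1" "B x2 y2" "B x3 y3" "x1 < x2" "x2 < x3"
    and "{y1, y2, y3} = {u1, u2, u3}" "u1 < u2" "u2 < u3"
    and s: "\<And>i j. (i, j) \<in> S \<Longrightarrow> (i = 1 \<and> y1 = [u1, u2, u3] ! (j - 1) \<or> i = 2 \<and> y2 = [u1, u2, u3] ! (j - 1)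
      \<or> i = 3 \<and> y3 = [u1, u2, u3] ! (j - 1))"
  shows "contains (perm3 S) (k, l, B)"
proof -
  have b: "1 \<le> x \<and> x \<le> k \<and> 1 \<le> y \<and> y \<le> l" if "B x y" for x y
    using assms(1) that unfolding is_mat_iff by blast
  define r where "r t = (if t = 0 then 0 else if t = 1 then x1 else if t = 2 then x2 else k)" for t :: nat
  define c where "c t = (if t = 0 then 0 else if t = 1 then u1 else if t = 2 then u2 else l)" for t :: nat
  have less3: "(\<forall>t<3. Q t) \<longleftrightarrow> Q 0 \<and> Q 1 \<and> Q 2" for Q :: "nat \<Rightarrow> bool"
    by (auto simp: numeral_3_eq_3 less_Suc_eq numeral_2_eq_2)
  have x: "1 \<le> x1" "x3 \<le> k" using b assms(2,4) by blast+
  have "1 \<le> y \<and> y \<le> l" if "y \<in> {y1, y2, y3}" for y using that b assms(2-4) by blast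
  then have u: "1 \<le> u1" "u3 \<le> l" unfolding assms(7) by blast+
  have col: "c (j - 1) < [u1, u2, u3] ! (j - 1) \<and> [u1, u2, u3] ! (j - 1) \<le> c j" if "1 \<le> j" "j \<le> 3" for j
  proof -
    from that consider "j = 1" | "j = 2" | "j = 3" by linarith
    then show ?thesis using u assms(8,9) by cases (simp_all add: c_def)
  qed
  show ?thesis unfolding perm3_def
  proof (rule containsI[of 3 k r 3 l c])
    show "cuts 3 k r" using x assms(5,6) unfolding cuts_def less3 by (simp add: r_def)
    show "cuts 3 l c" using u assms(8,9) unfolding cuts_def less3 by (simp add: c_def)
  next
    fix i j :: nat assume ij: "1 \<le> j" "j \<le> 3" "(i, j) \<in> S"
    from s[OF ij(3)] show "hit B r c i j"
    proof (elim disjE conjE)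
      assume 1: "i = 1" "y1 = [u1, u2, u3] ! (j - 1)"
      show ?thesis
        by (rule hitI[of _ _ x1 _ _ y1]) (use 1 x col[OF ij(1,2)] assms(2-6) in \<open>simp_all add: r_def\<close>)
    next
      assume 2: "i = 2" "y2 = [u1, u2, u3] ! (j - 1)"
      show ?thesis
        by (rule hitI[of _ _ x2 _ _ y2]) (use 2 x col[OF ij(1,2)] assms(2-6) in \<open>simp_all add: r_def\<close>)
    next
      assume 3: "i = 3" "y3 = [u1, u2, u3] ! (j - 1)"
      show ?thesis
        by (rule hitI[of _ _ x3 _ _ y3]) (use 3 x col[OF ij(1,2)] assms(2-6) in \<open>simp_all add: r_def\<close>)
    qed
  qed
qed

lemma contains_perm3D:
  assumes "contains (perm3 {(1, s1), (2, s2), (3, s3)}) (k, l, B)"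
    and s: "1 \<le> s1" "s1 \<le> 3" "1 \<le> s2" "s2 \<le> 3" "1 \<le> s3" "s3 \<le> 3"
  shows "\<exists>x1 y1 x2 y2 x3 y3. B x1 y1 \<and> B x2 y2 \<and> B x3 y3 \<and> x1 < x2 \<and> x2 < x3 \<and>
    (s1 < s2 \<longrightarrow> y1 < y2) \<and> (s2 < s1 \<longrightarrow> y2 < y1) \<and> (s2 < s3 \<longrightarrow> y2 < y3) \<and>
    (s3 < s2 \<longrightarrow> y3 < y2) \<and> (s1 < s3 \<longrightarrow> y1 < y3) \<and> (s3 < s1 \<longrightarrow> y3 < y1)"
proof -
  obtain r c where rc: "cuts 3 k r" "cuts 3 l c"
    "\<And>x y. 1 \<le> x \<Longrightarrow> x \<le> 3 \<Longrightarrow> 1 \<le> y \<Longrightarrow> y \<le> 3 \<Longrightarrow> (x, y) \<in> {(1, s1), (2, s2), (3, s3)} \<Longrightarrow> hit B r c x y"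
    using assms(1) unfolding perm3_def contains_iff by metis
  have "hit B r c 1 s1" "hit B r c 2 s2" "hit B r c 3 s3"
    using rc(3)[of 1 s1] rc(3)[of 2 s2] rc(3)[of 3 s3] s by simp_all
  then obtain x1 y1 x2 y2 x3 y3 where
    1: "x1 \<le> r 1" "c (s1 - 1) < y1" "y1 \<le> c s1" "B x1 y1" and
    2: "r (2 - 1) < x2" "x2 \<le> r 2" "c (s2 - 1) < y2" "y2 \<le> c s2" "B x2 y2" and
    3: "r (3 - 1) < x3" "c (s3 - 1) < y3" "y3 \<le> c s3" "B x3 y3"
    unfolding hit_def by metis
  have lt: "y < y'" if "c (u - 1) < y" "y \<le> c u" "c (v - 1) < y'" "y' \<le> c v" "v \<le> 3" "u < v" for u v y y'
    using cuts_mono[OF rc(2), of u "v - 1"] that by linarith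
  have "x1 < x2" "x2 < x3" using 1 2 3 by simp_all
  then show ?thesis
    using lt[OF 1(2,3) 2(3,4)] lt[OF 2(3,4) 3(2,3)] lt[OF 1(2,3) 3(2,3)]
      lt[OF 2(3,4) 1(2,3)] lt[OF 3(2,3) 2(3,4)] lt[OF 3(2,3) 1(2,3)] 1 2 3 s by blast
qed

text \<open>Of the six orders of three columns only 123 and 321 are monotone; the other four are
  \<open>Q1\<close> (213), \<open>Q2\<close> (231), \<open>Q3\<close> (132) and \<open>Q4\<close>
  (312). Different rows or columns of a permutation pattern come from disjoint blocks, so only
  triples in distinct rows and columns count.\<close>

lemma avoids_Q_iff:
  assumes "is_mat (k, l, B)"
  shows "(\<not> contains Q1 (k, l, B) \<and> \<not> contains Q2 (k, l, B) \<and>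
    \<not> contains Q3 (k, l, B) \<and> \<not> contains Q4 (k, l, B)) \<longleftrightarrow> monotone_triples B"
    (is "?avoid \<longleftrightarrow> ?mono")
proof
  assume av: ?avoid
  show ?mono unfolding monotone_triples_def
  proof (intro allI impI, rule ccontr)
    fix x1 x2 x3 y1 y2 y3
    assume B: "B x1 y1" "B x2 y2" "B x3 y3" "x1 < x2" "x2 < x3"
      and y: "y1 \<noteq> y2" "y2 \<noteq> y3" "y1 \<noteq> y3" "\<not> (y1 < y2 \<and> y2 < y3 \<or> y3 < y2 \<and> y2 < y1)"
    note P = contains_perm3[OF assms B]
    from y consider "y2 < y1" "y1 < y3" | "y3 < y1" "y1 < y2" | "y1 < y3" "y3 < y2" | "y2 < y3" "y3 < y1"
      by linarith
    then have "contains Q1 (k, l, B) \<or> contains Q2 (k, l, B) \<or> contains Q3 (k, l, B) \<or> contains Q4 (k, l, B)"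
    proof cases
      case 1 have "contains Q1 (k, l, B)" unfolding Q1_def by (rule P[OF _ 1]) auto
      then show ?thesis by simp
    next
      case 2 have "contains Q2 (k, l, B)" unfolding Q2_def by (rule P[OF _ 2]) auto
      then show ?thesis by simp
    next
      case 3 have "contains Q3 (k, l, B)" unfolding Q3_def by (rule P[OF _ 3]) auto
      then show ?thesis by simp
    next
      case 4 have "contains Q4 (k, l, B)" unfolding Q4_def by (rule P[OF _ 4]) auto
      then show ?thesis by simp
    qed
    with av show False by blast
  qed
next
  assume ?mono
  then have m: "False" if "B x1 y1 \<and> B x2 y2 \<and> B x3 y3 \<and> x1 < x2 \<and> x2 < x3 \<and> y1 \<noteq> y2 \<and> y2 \<noteq> y3 \<and> y1 \<noteq> y3 \<and>
      \<not> (y1 < y2 \<and> y2 < y3) \<and> \<not> (y3 < y2 \<and> y2 < y1)" for x1 y1 x2 y2 x3 y3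
    using that unfolding monotone_triples_def by blast
  show ?avoid
  proof (intro conjI notI)
    assume "contains Q1 (k, l, B)"
    then obtain x1 y1 x2 y2 x3 y3 where "B x1 y1" "B x2 y2" "B x3 y3" "x1 < x2" "x2 < x3" "y2 < y1" "y1 < y3"
      unfolding Q1_def by (drule_tac contains_perm3D) auto
    with m[of x1 y1 x2 y2 x3 y3] show False by auto
  next
    assume "contains Q2 (k, l, B)"
    then obtain x1 y1 x2 y2 x3 y3 where "B x1 y1" "B x2 y2" "B x3 y3" "x1 < x2" "x2 < x3" "y3 < y1" "y1 < y2"
      unfolding Q2_def by (drule_tac contains_perm3D) auto
    with m[of x1 y1 x2 y2 x3 y3] show False by auto
  next
    assume "contains Q3 (k, l, B)"
    then obtain x1 y1 x2 y2 x3 y3 where "B x1 y1" "B x2 y2" "B x3 y3" "x1 < x2" "x2 < x3" "y1 < y3" "y3 < y2"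
      unfolding Q3_def by (drule_tac contains_perm3D) auto
    with m[of x1 y1 x2 y2 x3 y3] show False by auto
  next
    assume "contains Q4 (k, l, B)"
    then obtain x1 y1 x2 y2 x3 y3 where "B x1 y1" "B x2 y2" "B x3 y3" "x1 < x2" "x2 < x3" "y2 < y3" "y3 < y1"
      unfolding Q4_def by (drule_tac contains_perm3D) auto
    with m[of x1 y1 x2 y2 x3 y3] show False by auto
  qed
qed

subsection \<open>Patterns with a non-monotone triple\<close>

text \<open>Ones are added as long as the pattern stays avoided; each step lowers the number of
  zeros within the range.\<close>

lemma exists_critical:
  assumes "is_mat (m, n, A)" "\<not> contains P (m, n, A)"
  shows "\<exists>A'. (\<forall>i j. A i j \<longrightarrow> A' i j) \<and> critical (Av P) (m, n, A')"
  using assms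
proof (induction "card {(i, j). i \<in> {1..m} \<and> j \<in> {1..n} \<and> \<not> A i j}" arbitrary: A rule: less_induct)
  case less
  show ?case
  proof (cases "critical (Av P) (m, n, A)")
    case True
    then show ?thesis by blast
  next
    case False
    then obtain i j where ij: "1 \<le> i" "i \<le> m" "1 \<le> j" "j \<le> n" "\<not> A i j"
      and Av: "(m, n, A(i := (A i)(j := True))) \<in> Av P"
      using less.prems unfolding critical_def Av_def by auto
    let ?A = "A(i := (A i)(j := True))"
    have "finite {(i, j). i \<in> {1..m} \<and> j \<in> {1..n} \<and> \<not> A i j}"
      by (rule finite_subset[of _ "{1..m} \<times> {1..n}"]) auto
    then have "card {(i, j). i \<in> {1..m} \<and> j \<in> {1..n} \<and> \<not> ?A i j} < card {(i, j). i \<in> {1..m} \<and> j \<in> {1..n} \<and> \<not> A i j}"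
      by (rule psubset_card_mono) (use ij in \<open>auto simp: psubset_eq set_eq_iff split: if_splits\<close>)
    then obtain A' where "\<forall>i j. ?A i j \<longrightarrow> A' i j" "critical (Av P) (m, n, A')"
      using less.hyps[of ?A] Av unfolding Av_def by blast
    then show ?thesis by (intro exI[of _ A']) (metis fun_upd_apply)
  qed
qed

text \<open>The two conditions on the neighbours are made symmetric so that the notion is invariant
  under reflections.\<close>

definition blocked_row :: "bmat \<Rightarrow> nat \<Rightarrow> bool" where
  "blocked_row P N \<longleftrightarrow> (\<exists>m n A i Z. is_mat (m, n, A) \<and> \<not> contains P (m, n, A) \<and> 1 \<le> i \<and> i \<le> m \<and>
     finite Z \<and> N \<le> card Z \<and>
     (\<forall>z\<in>Z. \<not> A i z \<and> A i (z - 1) \<and> A i (z + 1) \<and> contains P (m, n, A(i := (A i)(z := True)))))"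

lemma not_row_boundedI:
  assumes "\<And>N. blocked_row P N"
  shows "\<not> row_bounded (Av P)"
proof
  assume "row_bounded (Av P)"
  then obtain N where N: "\<And>M i. critical (Av P) M \<Longrightarrow> 1 \<le> i \<Longrightarrow> i \<le> fst M \<Longrightarrow> row_complexity M i \<le> N"
    unfolding row_bounded_def Ball_def atLeastAtMost_iff by blast
  obtain m n A i Z where A: "is_mat (m, n, A)" "\<not> contains P (m, n, A)" and i: "1 \<le> i" "i \<le> m"
    and Z: "finite Z" "Suc N \<le> card Z"
    "\<And>z. z \<in> Z \<Longrightarrow> \<not> A i z \<and> A i (z - 1) \<and> A i (z + 1) \<and> contains P (m, n, A(i := (A i)(z := True)))"
    using assms[of "Suc N"] unfolding blocked_row_def by metis
  obtain A' where A': "\<And>i j. A i j \<Longrightarrow> A' i j" "critical (Av P) (m, n, A')"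
    using exists_critical[OF A] by blast
  \<comment> \<open>Each hole is the left endpoint of its own 0-run in the critical matrix, as its
    left neighbour remains a one.\<close>
  have "z \<in> {j \<in> {1..n}. \<not> A' i j \<and> (j = 1 \<or> A' i (j - 1))}" if z: "z \<in> Z" for z
  proof -
    have "1 \<le> z - 1" "z + 1 \<le> n" using Z(3)[OF z] A(1) unfolding is_mat_iff by blast+
    moreover have "\<not> A' i z"
    proof
      assume "A' i z"
      then have "contains P (m, n, A')"
        using Z(3)[OF z] A'(1) contains_mono[of P m n "A(i := (A i)(z := True))" A'] by (metis fun_upd_apply)
      then show False using A'(2) unfolding critical_def Av_def by blast
    qed
    ultimately show ?thesis using Z(3)[OF z] A'(1) by auto
  qed
  then have "card Z \<le> card {j \<in> {1..n}. \<not> A' i j \<and> (j = 1 \<or> A' i (j - 1))}"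
    by (intro card_mono) auto
  also have "\<dots> = row_complexity (m, n, A') i" by (simp add: row_complexity_def)
  also have "\<dots> \<le> N" using N[OF A'(2)] i by simp
  finally show False using Z(2) by simp
qed

lemma blocked_row_hflip:
  assumes "is_mat P" "blocked_row P N"
  shows "blocked_row (hflip P) N"
proof -
  obtain m n A i Z where A: "is_mat (m, n, A)" "\<not> contains P (m, n, A)" and i: "1 \<le> i" "i \<le> m"
    and Z: "finite Z" "N \<le> card Z"
    "\<And>z. z \<in> Z \<Longrightarrow> \<not> A i z \<and> A i (z - 1) \<and> A i (z + 1) \<and> contains P (m, n, A(i := (A i)(z := True)))"
    using assms(2) unfolding blocked_row_def by metis
  let ?A = "\<lambda>i j. A i (n + 1 - j)"
  have zn: "1 < z \<and> z + 1 \<le> n" if "z \<in> Z" for z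
    using Z(3)[OF that] A(1) unfolding is_mat_iff by fastforce
  have flip: "hflip (m, n, A(i := (A i)(z := True))) = (m, n, ?A(i := (?A i)(n + 1 - z := True)))"
    if "z \<in> Z" for z
    using zn[OF that] unfolding hflip_def by (auto simp: fun_eq_iff)
  show ?thesis unfolding blocked_row_def
  proof (intro exI conjI ballI)
    show "is_mat (m, n, ?A)" using is_mat_hflip[OF A(1)] by (simp add: hflip_def)
    show "\<not> contains (hflip P) (m, n, ?A)"
      using contains_hflip_iff[OF assms(1) A(1)] A(2) by (simp add: hflip_def)
    show "1 \<le> i" "i \<le> m" by fact+
    show "finite ((\<lambda>z. n + 1 - z) ` Z)" using Z by simp
    have "inj_on (\<lambda>z. n + 1 - z) Z" using zn by (intro inj_onI) fastforce
    then show "N \<le> card ((\<lambda>z. n + 1 - z) ` Z)" using Z by (simp add: card_image)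
  next
    fix z' assume "z' \<in> (\<lambda>z. n + 1 - z) ` Z"
    then obtain z where z: "z \<in> Z" "z' = n + 1 - z" by blast
    have e: "n + 1 - z' = z" "n + 1 - (z' - 1) = z + 1" "n + 1 - (z' + 1) = z - 1"
      using zn[OF z(1)] z(2) by auto
    show "\<not> ?A i z'" "?A i (z' - 1)" "?A i (z' + 1)" unfolding e using Z(3)[OF z(1)] by blast+
    show "contains (hflip P) (m, n, ?A(i := (?A i)(z' := True)))"
      using contains_hflip[of P "(m, n, A(i := (A i)(z := True)))"] Z(3)[OF z(1)]
      unfolding flip[OF z(1)] z(2) by blast
  qed
qed

lemma blocked_row_vflip:
  assumes "is_mat P" "blocked_row P N"
  shows "blocked_row (vflip P) N"
proof -
  obtain m n A i Z where A: "is_mat (m, n, A)" "\<not> contains P (m, n, A)" and i: "1 \<le> i" "i \<le> m"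
    and Z: "finite Z" "N \<le> card Z"
    "\<And>z. z \<in> Z \<Longrightarrow> \<not> A i z \<and> A i (z - 1) \<and> A i (z + 1) \<and> contains P (m, n, A(i := (A i)(z := True)))"
    using assms(2) unfolding blocked_row_def by metis
  let ?A = "\<lambda>i j. A (m + 1 - i) j"
  let ?i = "m + 1 - i"
  have i': "m + 1 - ?i = i" using i by simp
  have flip: "vflip (m, n, A(i := (A i)(z := True))) = (m, n, ?A(?i := (?A ?i)(z := True)))" for z
    using i unfolding vflip_def by (auto simp: fun_eq_iff)
  show ?thesis unfolding blocked_row_def
  proof (intro exI conjI ballI)
    show "is_mat (m, n, ?A)" using is_mat_vflip[OF A(1)] by (simp add: vflip_def)
    show "\<not> contains (vflip P) (m, n, ?A)"
      using contains_vflip_iff[OF assms(1) A(1)] A(2) by (simp add: vflip_def)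
    show "1 \<le> ?i" "?i \<le> m" "finite Z" "N \<le> card Z" using i Z by auto
  next
    fix z assume z: "z \<in> Z"
    show "\<not> ?A ?i z" "?A ?i (z - 1)" "?A ?i (z + 1)" unfolding i' using Z(3)[OF z] by blast+
    show "contains (vflip P) (m, n, ?A(?i := (?A ?i)(z := True)))"
      using contains_vflip[of P "(m, n, A(i := (A i)(z := True)))"] Z(3)[OF z]
      unfolding flip by blast
  qed
qed

text \<open>Full rows and columns outside the bounding box of the three points force every copy of the
  pattern to place them inside the central area; there the blocks lie on an antidiagonal, so the
  two points in increasing position share a block, and the block is exactly large enough.\<close>

locale triple_213 =
  fixes k l B r1 r2 r3 q1 q2 q3
  assumes P: "is_mat (k, l, B)"
    and B1: "B r1 q2" and B2: "B r2 q1" and B3: "B r3 q3"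
    and r12: "r1 < r2" and r23: "r2 < r3" and q12: "q1 < q2" and q23: "q2 < q3"
begin

text \<open>A block has the width \<open>L\<close> of the bounding box of the three points, so two
  points at the extreme columns leave the third no freedom: it falls on a hole column. Its height
  \<open>K\<close> is one less than that of the box, since row \<open>r1\<close> of the box belongs
  on the row with holes; the first and the third point thus never fit into one block.\<close>

definition K where "K = r3 - r1"
definition L where "L = q3 - q1 + 1"
definition m where "m N = r1 + N * K + (k - r3)"
definition n where "n N = q1 + N * L + (l - q3) - 1"

definition block :: "nat \<Rightarrow> nat \<Rightarrow> nat \<Rightarrow> bool" where
  "block N p q \<longleftrightarrow> (\<exists>s s'. s + s' + 1 = N \<and> q1 + s * L \<le> q \<and> q < q1 + s * L + L \<and>
     r1 + s' * K < p \<and> p \<le> r1 + s' * K + K)"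

definition A :: "nat \<Rightarrow> nat \<Rightarrow> nat \<Rightarrow> bool" where
  "A N p q \<longleftrightarrow> 1 \<le> p \<and> p \<le> m N \<and> 1 \<le> q \<and> q \<le> n N \<and>
     (p < r1 \<or> r1 + N * K < p \<or> q < q1 \<or> q1 + N * L \<le> q \<or>
      p = r1 \<and> (\<forall>s<N. q \<noteq> q2 + s * L) \<or> r1 < p \<and> block N p q)"

lemma bounds: "1 \<le> r1" "r3 \<le> k" "1 \<le> q1" "q3 \<le> l"
  using P B1 B2 B3 unfolding is_mat_iff by blast+

lemma mult_step: "s < t \<Longrightarrow> s * c + c \<le> t * (c::nat)"
  by (metis Suc_leI add.commute mult_Suc mult_le_mono1)

lemma is_mat_A: "is_mat (m N, n N, A N)" if "1 \<le> N"
proof -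
  have "L \<le> N * L" using mult_step[of 0 N L] that by simp
  then have "1 \<le> m N" "1 \<le> n N" using bounds by (auto simp: m_def n_def L_def)
  then show ?thesis unfolding is_mat_iff A_def by blast
qed

lemma avoid: "\<not> contains (k, l, B) (m N, n N, A N)" if "1 \<le> N"
proof
  assume "contains (k, l, B) (m N, n N, A N)"
  then obtain r c where rc: "cuts k (m N) r" "cuts l (n N) c"
    and hit: "\<And>x y. 1 \<le> x \<Longrightarrow> x \<le> k \<Longrightarrow> 1 \<le> y \<Longrightarrow> y \<le> l \<Longrightarrow> B x y \<Longrightarrow> hit (A N) r c x y"
    unfolding contains_iff by blast
  have "hit (A N) r c r1 q2" "hit (A N) r c r2 q1" "hit (A N) r c r3 q3"
    by (rule hit; use bounds r12 r23 q12 q23 B1 B2 B3 in simp)+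
  then obtain x1 y1 x2 y2 x3 y3 where
    1: "r (r1 - 1) < x1" "x1 \<le> r r1" "c (q2 - 1) < y1" "y1 \<le> c q2" "A N x1 y1" and
    2: "r (r2 - 1) < x2" "x2 \<le> r r2" "c (q1 - 1) < y2" "y2 \<le> c q1" "A N x2 y2" and
    3: "r (r3 - 1) < x3" "x3 \<le> r r3" "c (q3 - 1) < y3" "y3 \<le> c q3" "A N x3 y3"
    unfolding hit_def by metis
  note rg = cuts_gap[OF rc(1)] and cg = cuts_gap[OF rc(2)]
  have "r1 - 1 \<le> r (r1 - 1)" using cuts_ge[OF rc(1)] bounds r12 r23 by simp
  then have x1: "r1 \<le> x1" using 1 by linarith
  note ord = bounds r12 r23 q12 q23
  have r: "r r1 + (r2 - 1 - r1) \<le> r (r2 - 1)" "r r1 + (r3 - 1 - r1) \<le> r (r3 - 1)"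
    "r r2 + (r3 - 1 - r2) \<le> r (r3 - 1)"
    by (rule rg; use ord in linarith)+
  have x12: "x1 < x2" and x13: "x1 + (r3 - 1 - r1) < x3" and x23: "x2 < x3"
    using 1 2 3 r by linarith+
  have x3: "x3 \<le> r1 + N * K" using cuts_le[OF rc(1), of r3] 3 bounds unfolding m_def by linarith
  have "q1 - 1 \<le> c (q1 - 1)" using cuts_ge[OF rc(2)] bounds q12 q23 by simp
  then have y2: "q1 \<le> y2" using 2 by linarith
  have c21: "c q1 + (q2 - 1 - q1) \<le> c (q2 - 1)" by (rule cg; use ord in linarith)
  have c32: "c q2 + (q3 - 1 - q2) \<le> c (q3 - 1)" by (rule cg; use ord in linarith)
  have y3: "y3 < q1 + N * L"
    using cuts_le[OF rc(2), of q3] 3 bounds that mult_step[of 0 N L] unfolding n_def L_def by linarith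
  have y21: "y2 + (q2 - q1) \<le> y1" using 1 2 c21 q12 by linarith
  have y13: "y1 + (q3 - q2) \<le> y3" using 1 3 c32 q23 by linarith
  have "block N x2 y2" "block N x3 y3"
    using 2(5) 3(5) x1 x12 x23 x3 y2 y3 y21 y13 unfolding A_def by linarith+
  then obtain s s' t t' where
    s: "s + s' + 1 = N" "q1 + s * L \<le> y2" "y2 < q1 + s * L + L" "r1 + s' * K < x2" "x2 \<le> r1 + s' * K + K" and
    t: "t + t' + 1 = N" "q1 + t * L \<le> y3" "y3 < q1 + t * L + L" "r1 + t' * K < x3" "x3 \<le> r1 + t' * K + K"
    unfolding block_def by blast
  have "s = t"
  proof (rule ccontr)
    assume "s \<noteq> t"
    then consider "s < t" "t' < s'" | "t < s" "s' < t'" using s(1) t(1) by linarith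
    then show False
    proof cases
      case 1
      then show False using mult_step[OF 1(2), of K] s t x23 by linarith
    next
      case 2
      then show False using mult_step[OF 2(1), of L] s t y21 y13 q12 q23 by linarith
    qed
  qed
  then have st': "s' = t'" using s t by linarith
  have y1: "y1 = q2 + s * L"
    using s(2) t(3) y21 y13 q12 q23 L_def unfolding \<open>s = t\<close> by linarith
  have "s < N" using s by linarith
  then have "s * L + L \<le> N * L" by (rule mult_step)
  \<comment> \<open>The first point stands in the column of a hole, which excludes row
    \<open>r1\<close>; it would have to lie in a block.\<close>
  have "\<not> (x1 < r1 \<or> r1 + N * K < x1 \<or> y1 < q1 \<or> q1 + N * L \<le> y1)"
    using x1 x13 x3 y2 y21 y13 y3 by linarith
  then have "block N x1 y1"
    using 1(5) y1 \<open>s < N\<close> unfolding A_def by blast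
  then obtain u u' where
    u: "u + u' + 1 = N" "q1 + u * L \<le> y1" "y1 < q1 + u * L + L" "r1 + u' * K < x1" "x1 \<le> r1 + u' * K + K"
    unfolding block_def by blast
  have "u = s"
  proof (rule ccontr)
    assume "u \<noteq> s"
    then consider "u < s" | "s < u" by linarith
    then show False
    proof cases
      case 1
      then show False using mult_step[OF 1, of L] u y1 q12 by linarith
    next
      case 2
      then show False using mult_step[OF 2, of L] u y1 q12 q23 using L_def by linarith
    qed
  qed
  then have "u' = t'" using u s st' by linarith
  then show False using u(4) t(5) x13 r12 r23 K_def by simp
qed

text \<open>With the hole above block \<open>s\<close> filled, even the all-one \<open>k\<close> by
  \<open>l\<close> pattern is contained: the frame serves the rows and columns outside the box, the
  block serves the box without its top row, and row \<open>r1\<close> serves that top row. The row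
  block of \<open>r1\<close> therefore stretches from the row with holes down to the top of the
  chosen block.\<close>

lemma flip_contains:
  assumes "s < N"
  shows "contains (k, l, B) (m N, n N, (A N)(r1 := (A N r1)(q2 + s * L := True)))"
proof -
  define s' where "s' = N - 1 - s"
  have s': "s + s' + 1 = N" using assms by (simp add: s'_def)
  have sL: "s * L + L \<le> N * L" "s' * K + K \<le> N * K"
    using s' by (intro mult_step; linarith)+
  define r where "r t = (if t < r1 then t else if t < r3 then s' * K + t else m N + t - k)" for t
  define c where "c t = (if t < q1 then t else if t < q3 then s * L + t else n N + t - l)" for t
  have mk: "s' * K + r3 + (k - r3) \<le> m N" using sL bounds r12 r23 unfolding m_def K_def by linarith
  have nl: "s * L + q3 + (l - q3) \<le> n N" using sL bounds q12 q23 unfolding n_def L_def by linarith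
  note ord = bounds r12 r23 q12 q23
  let ?A = "(A N)(r1 := (A N r1)(q2 + s * L := True))"
  have full: "?A p q"
    if "1 \<le> p" "p \<le> m N" "1 \<le> q" "q \<le> n N" "p < r1 \<or> r1 + N * K < p \<or> q < q1 \<or> q1 + N * L \<le> q" for p q
    using that by (simp add: A_def) blast
  have inner: "?A (s' * K + x) (s * L + y)" if "r1 < x" "x \<le> r3" "q1 \<le> y" "y \<le> q3" for x y
  proof -
    have "block N (s' * K + x) (s * L + y)" unfolding block_def
      by (rule exI[of _ s], rule exI[of _ s']) (use s' that ord in \<open>auto simp: K_def L_def\<close>)
    then show ?thesis using that ord mk nl by (simp add: A_def)
  qed
  have top: "?A r1 (s * L + y)" if "q1 \<le> y" "y \<le> q3" for y
  proof (cases "y = q2")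
    case False
    have "s * L + y \<noteq> q2 + t * L" for t
    proof (cases t s rule: linorder_cases)
      case less
      then show ?thesis using mult_step[OF less, of L] that ord using L_def by linarith
    next
      case greater
      then show ?thesis using mult_step[OF greater, of L] that ord using L_def by linarith
    qed (use False in simp)
    moreover have "r1 \<le> m N" by (simp add: m_def)
    ultimately show ?thesis using that ord mk nl by (simp add: A_def add.commute)
  qed (simp add: add.commute)
  show ?thesis
  proof (rule containsI[of _ _ r _ _ c])
    show "cuts k (m N) r" unfolding cuts_def r_def using mk ord by auto
    show "cuts l (n N) c" unfolding cuts_def c_def using nl ord by auto
  next
    fix x y assume xy: "1 \<le> x" "x \<le> k" "1 \<le> y" "y \<le> l"
    define p where "p = (if x \<le> r1 then x else if x \<le> r3 then s' * K + x else m N + x - k)"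
    define q where "q = (if y < q1 then y else if y \<le> q3 then s * L + y else n N + y - l)"
    have p: "r (x - 1) < p" "p \<le> r x" "1 \<le> p" "p \<le> m N" using xy mk ord unfolding p_def r_def by auto
    have q: "c (y - 1) < q" "q \<le> c y" "1 \<le> q" "q \<le> n N" using xy nl ord unfolding q_def c_def by auto
    consider "x < r1" | "r3 < x" | "y < q1" | "q3 < y" | "x = r1" "q1 \<le> y" "y \<le> q3"
      | "r1 < x" "x \<le> r3" "q1 \<le> y" "y \<le> q3" by linarith
    then have "?A p q"
    proof cases
      case 1 then show ?thesis using full[of p q] p q by (simp add: p_def)
    next
      case 2
      then have "r1 + N * K < p" using xy ord unfolding p_def m_def by auto
      then show ?thesis using full[of p q] p q by blast
    next
      case 3 then show ?thesis using full[of p q] p q by (simp add: q_def)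
    next
      case 4
      then have "q1 + N * L \<le> q" using xy ord unfolding q_def n_def by auto
      then show ?thesis using full[of p q] p q by blast
    next
      case 5 then show ?thesis using top[of y] by (simp add: p_def q_def)
    next
      case 6 then show ?thesis using inner[of x y] by (simp add: p_def q_def)
    qed
    then show "hit ?A r c x y" using p q by (intro hitI[of _ _ p _ _ q])
  qed
qed

lemma blocked: "blocked_row (k, l, B) N"
proof -
  let ?N = "Suc N"
  have L: "0 < L" by (simp add: L_def)
  have center: "\<not> A ?N r1 (q2 + s * L) \<and> A ?N r1 (q2 + s * L - 1) \<and> A ?N r1 (q2 + s * L + 1)" if "s < ?N" for s
  proof -
    have sL: "s * L + L \<le> ?N * L" using that by (rule mult_step)
    have ne: "q2 + s * L - 1 \<noteq> q2 + t * L \<and> q2 + s * L + 1 \<noteq> q2 + t * L" for t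
    proof (cases t s rule: linorder_cases)
      case less
      then show ?thesis using mult_step[OF less, of L] q12 q23 bounds using L_def by linarith
    next
      case greater
      then show ?thesis using mult_step[OF greater, of L] q12 q23 bounds using L_def by linarith
    qed (use q12 in simp)
    have "r1 \<le> m ?N" by (simp add: m_def)
    moreover have "q2 + s * L + 1 \<le> n ?N" "q2 + s * L + 1 < q1 + ?N * L"
      using sL q12 q23 bounds unfolding n_def L_def by linarith+
    moreover have "\<not> block ?N r1 q" for q unfolding block_def by auto
    ultimately show ?thesis using ne that q12 q23 bounds sL unfolding A_def by auto
  qed
  show ?thesis unfolding blocked_row_def
  proof (intro exI conjI ballI)
    show "is_mat (m ?N, n ?N, A ?N)" "\<not> contains (k, l, B) (m ?N, n ?N, A ?N)"
      using is_mat_A avoid by simp_all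
    show "1 \<le> r1" "r1 \<le> m ?N" using bounds by (simp_all add: m_def)
    show "finite ((\<lambda>s. q2 + s * L) ` {..<?N})" by simp
    have "inj_on (\<lambda>s. q2 + s * L) {..<?N}" using L by (intro inj_onI) simp
    then show "N \<le> card ((\<lambda>s. q2 + s * L) ` {..<?N})" by (simp add: card_image)
  next
    fix z assume "z \<in> (\<lambda>s. q2 + s * L) ` {..<?N}"
    then obtain s where s: "s < ?N" "z = q2 + s * L" by blast
    show "\<not> A ?N r1 z" "A ?N r1 (z - 1)" "A ?N r1 (z + 1)"
      "contains (k, l, B) (m ?N, n ?N, (A ?N)(r1 := (A ?N r1)(z := True)))"
      using center[OF s(1)] flip_contains[OF s(1)] unfolding s(2) by blast+
  qed
qed

end

lemma not_row_bounded_if_not_monotone_triples: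
  assumes mat: "is_mat (k, l, B)" and "\<not> monotone_triples B"
  shows "\<not> row_bounded (Av (k, l, B))"
proof (rule not_row_boundedI)
  fix N
  obtain x1 x2 x3 y1 y2 y3 where B: "B x1 y1" "B x2 y2" "B x3 y3" "x1 < x2" "x2 < x3"
    and y: "y1 \<noteq> y2" "y2 \<noteq> y3" "y1 \<noteq> y3" "\<not> (y1 < y2 \<and> y2 < y3 \<or> y3 < y2 \<and> y2 < y1)"
    using assms(2) unfolding monotone_triples_def by blast
  have b: "1 \<le> x1" "x3 \<le> k" "1 \<le> y1" "y1 \<le> l" "1 \<le> y2" "y2 \<le> l" "1 \<le> y3" "y3 \<le> l"
    using mat B unfolding is_mat_iff by blast+
  have Ph: "is_mat (k, l, \<lambda>i j. B i (l + 1 - j))" using is_mat_hflip[OF mat] by (simp add: hflip_def)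
  have Pv: "is_mat (k, l, \<lambda>i j. B (k + 1 - i) j)" using is_mat_vflip[OF mat] by (simp add: vflip_def)
  have Phv: "is_mat (k, l, \<lambda>i j. B (k + 1 - i) (l + 1 - j))" using is_mat_hflip[OF Pv] by (simp add: hflip_def)
  have unh: "blocked_row (k, l, C) N"
    if "is_mat (k, l, C)" "blocked_row (k, l, \<lambda>i j. C i (l + 1 - j)) N" for C
    using blocked_row_hflip[of "hflip (k, l, C)" N] hflip_hflip[OF that(1)] is_mat_hflip[OF that(1)] that(2)
    by (simp add: hflip_def)
  have unv: "blocked_row (k, l, C) N"
    if "is_mat (k, l, C)" "blocked_row (k, l, \<lambda>i j. C (k + 1 - i) j) N" for C
    using blocked_row_vflip[of "vflip (k, l, C)" N] vflip_vflip[OF that(1)] is_mat_vflip[OF that(1)] that(2)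
    by (simp add: vflip_def)
  \<comment> \<open>The four orders are 213, 231, 132 and 312; the last three become 213 under the
    vertical axis, the half turn and the horizontal axis, respectively.\<close>
  from y consider "y2 < y1" "y1 < y3" | "y3 < y1" "y1 < y2" | "y1 < y3" "y3 < y2" | "y2 < y3" "y3 < y1"
    by linarith
  then show "blocked_row (k, l, B) N"
  proof cases
    case 1
    interpret triple_213 k l B x1 x2 x3 y2 y1 y3
      by unfold_locales (use mat B 1 in auto)
    show ?thesis by (rule blocked)
  next
    case 2
    interpret triple_213 k l "\<lambda>i j. B i (l + 1 - j)" x1 x2 x3 "l + 1 - y2" "l + 1 - y1" "l + 1 - y3"
      by unfold_locales (use Ph B 2 b in auto)
    show ?thesis by (rule unh[of B, OF mat blocked])
  next
    case 3
    interpret triple_213 k l "\<lambda>i j. B (k + 1 - i) (l + 1 - j)" "k + 1 - x3" "k + 1 - x2" "k + 1 - x1"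
      "l + 1 - y2" "l + 1 - y3" "l + 1 - y1"
      by unfold_locales (use Phv B 3 b in auto)
    show ?thesis by (rule unv[of B, OF mat unh[of "\<lambda>i j. B (k + 1 - i) j", OF Pv blocked]])
  next
    case 4
    interpret triple_213 k l "\<lambda>i j. B (k + 1 - i) j" "k + 1 - x3" "k + 1 - x2" "k + 1 - x1" y2 y3 y1
      by unfold_locales (use Pv B 4 b in auto)
    show ?thesis by (rule unv[of B, OF mat blocked])
  qed
qed

subsection \<open>Gluing copies of the pattern\<close>

definition encloses :: "(nat \<Rightarrow> nat) \<Rightarrow> (nat \<Rightarrow> nat) \<Rightarrow> nat \<Rightarrow> bool" where
  "encloses r r' x \<longleftrightarrow> r (x - 1) \<le> r' (x - 1) \<and> r' x \<le> r x"

text \<open>At a single common row \<open>x\<close>, the merged cuts take the smaller lower bound and the larger upper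
  bound, so that the new block contains both old ones.\<close>

lemma merge_cuts:
  assumes c1: "cuts k m r1" and c2: "cuts k m r2"
    and S: "\<And>x y. S1 x \<Longrightarrow> S2 y \<Longrightarrow> x = y" "\<And>x. S1 x \<Longrightarrow> 1 \<le> x \<and> x \<le> k"
  shows "\<exists>r. cuts k m r \<and> (\<forall>t. r t = r1 t \<or> r t = r2 t) \<and> (\<forall>x. S1 x \<longrightarrow> encloses r r1 x) \<and>
    (\<forall>x. S2 x \<longrightarrow> encloses r r2 x) \<and> (\<forall>x. encloses r r1 x \<or> encloses r r2 x)"
proof -
  consider "\<And>x. \<not> S2 x" | "\<And>x. \<not> S1 x" | x where "S1 x" "\<And>y. S1 y \<longrightarrow> y = x" "\<And>y. S2 y \<longrightarrow> y = x"
    using S(1) by metis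
  then show ?thesis
  proof cases
    case 1 then show ?thesis using c1 by (intro exI[of _ r1]) (simp add: encloses_def)
  next
    case 2 then show ?thesis using c2 by (intro exI[of _ r2]) (simp add: encloses_def)
  next
    case (3 x)
    define f where "f = (if r1 (x - 1) \<le> r2 (x - 1) then r1 else r2)"
    define g where "g = (if r1 x \<le> r2 x then r2 else r1)"
    have fg: "cuts k m f" "cuts k m g" "f = r1 \<or> f = r2" "g = r1 \<or> g = r2"
      "f (x - 1) \<le> r1 (x - 1)" "f (x - 1) \<le> r2 (x - 1)" "r1 x \<le> g x" "r2 x \<le> g x"
      using c1 c2 unfolding f_def g_def by auto
    have x: "1 \<le> x" "x \<le> k" using S(2) 3(1) by auto
    have "f (x - 1) < g x" using cuts_strict[OF c1, of "x - 1" x] fg x by simp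
    then have cuts: "cuts k m (\<lambda>t. if t < x then f t else g t)"
      using cuts_splice[OF fg(1,2) x] by blast
    let ?r = "\<lambda>t. if t < x then f t else g t"
    have "encloses ?r r1 x" "encloses ?r r2 x" using fg x unfolding encloses_def by auto
    moreover have "encloses ?r f y" if "y < x" for y
      using that less_imp_diff_less[of y x 1] by (simp add: encloses_def)
    moreover have "encloses ?r g y" if "x < y" for y using that by (auto simp: encloses_def)
    ultimately have "encloses ?r r1 y \<or> encloses ?r r2 y" for y
      using fg(3,4) by (cases y x rule: linorder_cases) metis+
    moreover have "?r t = r1 t \<or> ?r t = r2 t" for t using fg(3,4) by auto
    moreover have "S1 y \<longrightarrow> encloses ?r r1 y" "S2 y \<longrightarrow> encloses ?r r2 y" for y
      using 3(2,3) \<open>encloses ?r r1 x\<close> \<open>encloses ?r r2 x\<close> by blast+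
    ultimately show ?thesis using cuts by (intro exI[of _ ?r] conjI allI)
  qed
qed

text \<open>A row \<open>i\<close> of a matrix avoiding the pattern \<open>B\<close>, with zeros \<open>z j\<close> separated by ones \<open>d j\<close>; turning
  any of these zeros into a one produces a copy of \<open>B\<close> (with row cuts \<open>R j\<close> and column cuts \<open>C j\<close>)
  in which the new one plays the role of the fixed entry \<open>(a, b)\<close>.\<close>

locale blocked_zeros =
  fixes k l B m n A a b i N z d R C
  assumes P: "is_mat (k, l, B)" and M: "is_mat (m, n, A)"
    and mono: "monotone_triples B"
    and avoids: "\<not> contains (k, l, B) (m, n, A)"
    and Bab: "B a b"
    and sep: "\<And>j. Suc j < N \<Longrightarrow> z j < d j \<and> d j < z (Suc j) \<and> A i (d j)"
    and cR: "\<And>j. j < N \<Longrightarrow> cuts k m (R j)"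
    and cC: "\<And>j. j < N \<Longrightarrow> cuts l n (C j)"
    and row: "\<And>j. j < N \<Longrightarrow> R j (a - 1) < i \<and> i \<le> R j a"
    and col: "\<And>j. j < N \<Longrightarrow> C j (b - 1) < z j \<and> z j \<le> C j b"
    and hits: "\<And>j x y. j < N \<Longrightarrow> B x y \<Longrightarrow> (x, y) \<noteq> (a, b) \<Longrightarrow> hit A (R j) (C j) x y"
begin

section \<open>Position of the separating ones relative to the copies\<close>

lemma B_bounds: "B x y \<Longrightarrow> 1 \<le> x \<and> x \<le> k \<and> 1 \<le> y \<and> y \<le> l"
  using P unfolding is_mat_iff by blast

lemma ab: "1 \<le> a" "a \<le> k" "1 \<le> b" "b \<le> l"
  using B_bounds[OF Bab] by auto

lemma triple:
  "B x1 y1 \<Longrightarrow> B x2 y2 \<Longrightarrow> B x3 y3 \<Longrightarrow> x1 < x2 \<Longrightarrow> x2 < x3 \<Longrightarrow>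
    y1 = y2 \<or> y2 = y3 \<or> y1 = y3 \<or> y1 < y2 \<and> y2 < y3 \<or> y3 < y2 \<and> y2 < y1"
  using mono unfolding monotone_triples_def by blast

lemma z_mono: "j \<le> j' \<Longrightarrow> j' < N \<Longrightarrow> z j \<le> z j'"
proof (induction j' rule: dec_induct)
  case (step t)
  then show ?case using sep[of t] by simp
qed simp

lemma z_less_d: "j \<le> p \<Longrightarrow> Suc p < N \<Longrightarrow> z j < d p"
  using z_mono[of j p] sep[of p] by simp

lemma d_less_z: "p < j \<Longrightarrow> j < N \<Longrightarrow> d p < z j"
  using z_mono[of "Suc p" j] sep[of p] by simp

lemma d_strict: "p < q \<Longrightarrow> Suc q < N \<Longrightarrow> d p < d q"
  using d_less_z[of p q] sep[of q] by simp

lemma d_mono: "p \<le> q \<Longrightarrow> Suc q < N \<Longrightarrow> d p \<le> d q"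
  using d_strict[of p q] by (cases "p = q") auto

lemma A_d: "Suc p < N \<Longrightarrow> A i (d p)"
  using sep by blast

text \<open>Such a one would take over the role of the new entry, and copy \<open>j\<close> would
  already be present in the avoiding matrix. Hence every separating one lies strictly to one side of
  column block \<open>b\<close> of each copy.\<close>

lemma no_one_in_block:
  assumes "j < N" "A i q"
  shows "q \<le> C j (b - 1) \<or> C j b < q"
proof (rule ccontr)
  assume "\<not> ?thesis"
  then have "hit A (R j) (C j) a b"
    using row[OF assms(1)] assms(2) by (intro hitI[of _ _ i _ _ q]) auto
  then have "contains (k, l, B) (m, n, A)"
    using hits[OF assms(1)] by (intro containsI[OF cR[OF assms(1)] cC[OF assms(1)]]) blast
  then show False using avoids by blast
qed

lemma C_less_d: "j \<le> p \<Longrightarrow> Suc p < N \<Longrightarrow> C j b < d p"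
  using no_one_in_block[of j "d p"] col[of j] z_less_d[of j p] A_d[of p] by linarith

lemma d_le_C: "p < j \<Longrightarrow> j < N \<Longrightarrow> d p \<le> C j (b - 1)"
  using no_one_in_block[of j "d p"] col[of j] d_less_z[of p j] A_d[of p] by linarith

lemma C_mono: "j < N \<Longrightarrow> s \<le> t \<Longrightarrow> t \<le> l \<Longrightarrow> C j s \<le> C j t"
  using cuts_mono[OF cC] by blast

lemma C_strict: "j < N \<Longrightarrow> s < t \<Longrightarrow> t \<le> l \<Longrightarrow> C j s < C j t"
  using cuts_strict[OF cC] by blast

text \<open>The columns before \<open>\<alpha>\<close> are taken from copy \<open>j\<close>, those after \<open>\<beta>\<close> from copy \<open>j'\<close>, and the entries of
  row \<open>a\<close> in between are placed on ones of row \<open>i\<close>.  As the pattern is avoided, no such gluing exists.\<close>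

lemma glue:
  assumes j: "j < j'" "j' < N" and \<alpha>: "1 \<le> \<alpha>" "\<alpha> \<le> b" and \<beta>: "b \<le> \<beta>" "\<beta> \<le> l" "j + (\<beta> - \<alpha>) < j'"
    and r: "cuts k m r" "r (a - 1) < i" "i \<le> r a"
    and entries: "\<And>x y. B x y \<Longrightarrow> x = a \<and> \<alpha> \<le> y \<and> y \<le> \<beta> \<or> y \<le> \<alpha> \<and> encloses r (R j) x \<or>
      \<beta> \<le> y \<and> encloses r (R j') x"
  shows False
proof -
  \<comment> \<open>The ones \<open>d j\<close>, ..., \<open>d (j + (\<beta> - \<alpha>))\<close>
    lie after column block \<open>b\<close> of copy \<open>j\<close> and before that of copy
    \<open>j'\<close>. Cutting at them gives each column from \<open>\<alpha>\<close> to
    \<open>\<beta>\<close> its own one, while block \<open>\<alpha>\<close> still covers that of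
    copy \<open>j\<close> and block \<open>\<beta>\<close> that of copy \<open>j'\<close>.\<close>
  define c where "c t = (if t < \<alpha> then C j t else if t < \<beta> then d (j + (t - \<alpha>)) else C j' t)" for t
  have jN: "j < N" using j by simp
  have le: "C j (\<alpha> - 1) < d j" "C j (\<alpha> - 1) < C j' b" "C j \<alpha> < d j"
    using C_mono[OF jN, of "\<alpha> - 1" b] C_mono[OF jN, of \<alpha> b] C_less_d[of j j] d_le_C[of j j'] C_mono[of j' "b - 1" b] \<alpha> \<beta> j
    by fastforce+
  have ge: "d (j + t) \<le> C j' (\<beta> - 1)" "d (j + t) < C j' \<beta>" if "t \<le> \<beta> - \<alpha>" for t
    using d_le_C[of "j + t" j'] C_mono[of j' "b - 1" "\<beta> - 1"] C_strict[of j' "\<beta> - 1" \<beta>] that \<alpha> \<beta> j by fastforce+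
  have dd: "d (j + s) < d (j + t)" if "s < t" "t \<le> \<beta> - \<alpha>" for s t
    by (rule d_strict) (use that \<beta>(3) j(2) in linarith)+
  have "cuts l n c" unfolding cuts_def
  proof (intro conjI allI impI)
    show "c 0 = 0" using cuts_0[OF cC[OF jN]] \<alpha> by (simp add: c_def)
    show "c l = n" using cuts_top[OF cC[OF j(2)]] \<alpha> \<beta> by (simp add: c_def)
    fix t assume t: "t < l"
    consider "Suc t < \<alpha>" | "Suc t = \<alpha>" "\<alpha> < \<beta>" | "Suc t = \<alpha>" "\<alpha> = \<beta>" | "\<alpha> \<le> t" "Suc t < \<beta>" | "\<alpha> \<le> t" "Suc t = \<beta>" | "\<beta> \<le> t"
      using \<alpha> \<beta> by linarith
    then show "c t < c (Suc t)"
    proof cases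
      case 1 then show ?thesis using C_strict[OF jN, of t "Suc t"] t by (simp add: c_def)
    next
      case 2 then show ?thesis using le by (auto simp: c_def)
    next
      case 3 then show ?thesis using le \<alpha> \<beta> by (auto simp: c_def)
    next
      case 4 then show ?thesis using dd[of "t - \<alpha>" "Suc t - \<alpha>"] by (simp add: c_def)
    next
      case 5 then show ?thesis using ge[of "t - \<alpha>"] by (simp add: c_def)
    next
      case 6 then show ?thesis using C_strict[OF j(2), of t "Suc t"] t \<alpha> \<beta> by (simp add: c_def)
    qed
  qed
  have left: "c (y - 1) \<le> C j (y - 1)" "C j y \<le> c y" if "1 \<le> y" "y \<le> \<alpha>" for y
  proof -
    have "y - 1 < \<alpha>" using that by linarith
    then show "c (y - 1) \<le> C j (y - 1)" by (simp add: c_def)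
    show "C j y \<le> c y"
    proof (cases "y < \<alpha>")
      case False
      then have "y = \<alpha>" using that by simp
      moreover have "C j \<alpha> \<le> C j' \<alpha>" if "\<not> \<alpha> < \<beta>"
      proof -
        have "\<beta> = \<alpha>" using that \<alpha> \<beta> by simp
        then show ?thesis using le(3) ge(2)[of 0] by simp
      qed
      ultimately show ?thesis using le by (auto simp: c_def)
    qed (simp add: c_def)
  qed
  have right: "c (y - 1) \<le> C j' (y - 1)" "C j' y \<le> c y" if "\<beta> \<le> y" for y
  proof -
    show "C j' y \<le> c y" using that \<alpha> \<beta> by (simp add: c_def)
    show "c (y - 1) \<le> C j' (y - 1)"
    proof (cases "y = \<beta>")
      case True
      show ?thesis
      proof (cases "\<alpha> < \<beta>")
        case False
        then have "\<alpha> = b" "\<beta> = b" using \<alpha> \<beta> by auto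
        then show ?thesis using True le(1) d_le_C[OF j] \<alpha> by (simp add: c_def)
      next
        case t: True
        then show ?thesis using True ge(1)[of "\<beta> - 1 - \<alpha>"] \<alpha> by (auto simp: c_def)
      qed
    next
      case False
      then show ?thesis using that \<alpha> \<beta> by (auto simp: c_def)
    qed
  qed
  have mid: "c (y - 1) < d (j + (y - \<alpha>))" "d (j + (y - \<alpha>)) \<le> c y" if "\<alpha> \<le> y" "y \<le> \<beta>" for y
  proof -
    show "d (j + (y - \<alpha>)) \<le> c y"
    proof (cases "y < \<beta>")
      case False
      then have "y = \<beta>" using that by simp
      then show ?thesis using ge(2)[of "\<beta> - \<alpha>"] \<alpha> \<beta> by (simp add: c_def)
    qed (use that in \<open>simp add: c_def\<close>)
    show "c (y - 1) < d (j + (y - \<alpha>))"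
    proof (cases "y = \<alpha>")
      case True
      then show ?thesis using le(1) \<alpha> by (simp add: c_def)
    next
      case False
      then have "\<not> y - 1 < \<alpha>" "y - 1 < \<beta>" "y - 1 - \<alpha> < y - \<alpha>" "y - \<alpha> \<le> \<beta> - \<alpha>"
        using that by linarith+
      then show ?thesis using dd[of "y - 1 - \<alpha>" "y - \<alpha>"] by (simp only: c_def if_True if_False)
    qed
  qed
  have "contains (k, l, B) (m, n, A)"
  proof (rule containsI[OF r(1) \<open>cuts l n c\<close>])
    fix x y assume y: "1 \<le> y" and B: "B x y"
    show "hit A r c x y"
    proof (cases "x = a \<and> \<alpha> \<le> y \<and> y \<le> \<beta>")
      case True
      moreover have "A i (d (j + (y - \<alpha>)))" by (rule A_d) (use True \<beta>(3) j(2) in linarith)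
      ultimately show ?thesis using r mid by (intro hitI[of _ _ i _ _ "d (j + (y - \<alpha>))"]) auto
    next
      case False
      then have "(x, y) \<noteq> (a, b)" using \<alpha> \<beta> by auto
      then have h: "hit A (R j) (C j) x y" "hit A (R j') (C j') x y" using hits B jN j(2) by blast+
      from entries[OF B] False
      consider "y \<le> \<alpha>" "encloses r (R j) x" | "\<beta> \<le> y" "encloses r (R j') x" by blast
      then show ?thesis
      proof cases
        case 1 then show ?thesis using hit_mono[OF h(1)] left[OF y] unfolding encloses_def by blast
      next
        case 2 then show ?thesis using hit_mono[OF h(2)] right unfolding encloses_def by blast
      qed
    qed
  qed
  then show False using avoids by blast
qed

text \<open>Reflection reverses the order of the copies. As \<open>d p\<close> lies between
  \<open>z p\<close> and \<open>z (Suc p)\<close>, there is one separating one fewer than there are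
  zeros; hence \<open>N - 2 - j\<close> against \<open>N - 1 - j\<close>.\<close>

lemma hflipped: "blocked_zeros k l (\<lambda>x y. B x (l + 1 - y)) m n (\<lambda>p q. A p (n + 1 - q)) a (l + 1 - b) i N
  (\<lambda>j. n + 1 - z (N - 1 - j)) (\<lambda>j. n + 1 - d (N - 2 - j)) (\<lambda>j. R (N - 1 - j)) (\<lambda>j t. n - C (N - 1 - j) (l - t))"
proof
  show "is_mat (k, l, \<lambda>x y. B x (l + 1 - y))" using is_mat_hflip[OF P] by (simp add: hflip_def)
  show "is_mat (m, n, \<lambda>p q. A p (n + 1 - q))" using is_mat_hflip[OF M] by (simp add: hflip_def)
  show "monotone_triples (\<lambda>x y. B x (l + 1 - y))" by (rule monotone_triples_hflip[OF P mono])
  show "\<not> contains (k, l, \<lambda>x y. B x (l + 1 - y)) (m, n, \<lambda>p q. A p (n + 1 - q))"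
    using contains_hflip_iff[OF P M] avoids by (simp add: hflip_def)
  show "B a (l + 1 - (l + 1 - b))" using Bab ab by simp
  have zn: "z j \<le> n" if "j < N" for j
    using col[OF that] cuts_le[OF cC[OF that], of b] ab by linarith
  {
    fix j assume j: "Suc j < N"
    let ?p = "N - 2 - j"
    have p: "Suc ?p = N - 1 - j" "?p = N - 1 - Suc j" "Suc ?p < N" using j by auto
    have s: "z ?p < d ?p" "d ?p < z (Suc ?p)" "A i (d ?p)" using sep[OF p(3)] by auto
    have "z (Suc ?p) \<le> n" by (rule zn) (use p in simp)
    then show "n + 1 - z (N - 1 - j) < n + 1 - d ?p \<and> n + 1 - d ?p < n + 1 - z (N - 1 - Suc j) \<and>
      A i (n + 1 - (n + 1 - d ?p))"
      using s unfolding p(1)[symmetric] p(2)[symmetric] by (simp add: Suc_diff_le diff_less_mono2)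
  }
  fix j assume "j < N"
  then have j: "N - 1 - j < N" by simp
  show "cuts k m (R (N - 1 - j))" using cR[OF j] .
  show "cuts l n (\<lambda>t. n - C (N - 1 - j) (l - t))" by (rule cuts_flip[OF cC[OF j]])
  show "R (N - 1 - j) (a - 1) < i \<and> i \<le> R (N - 1 - j) a" using row[OF j] .
  have e: "l - (l + 1 - b - 1) = b" "l - (l + 1 - b) = b - 1" using ab by auto
  show "n - C (N - 1 - j) (l - (l + 1 - b - 1)) < n + 1 - z (N - 1 - j) \<and>
      n + 1 - z (N - 1 - j) \<le> n - C (N - 1 - j) (l - (l + 1 - b))"
    unfolding e using col[OF j] zn[OF j] by linarith
  fix x y assume B: "B x (l + 1 - y)" and ne: "(x, y) \<noteq> (a, l + 1 - b)"
  have y: "1 \<le> l + 1 - y" "l + 1 - y \<le> l" using B_bounds[OF B] by auto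
  have "(x, l + 1 - y) \<noteq> (a, b)" using ne y by auto
  from hit_hflip[OF hits[OF j B this] cC[OF j] y]
  show "hit (\<lambda>p q. A p (n + 1 - q)) (R (N - 1 - j)) (\<lambda>t. n - C (N - 1 - j) (l - t)) x y"
    using y by simp
qed

lemma vflipped: "blocked_zeros k l (\<lambda>x y. B (k + 1 - x) y) m n (\<lambda>p q. A (m + 1 - p) q) (k + 1 - a) b (m + 1 - i) N
  z d (\<lambda>j t. m - R j (k - t)) C"
proof
  show "is_mat (k, l, \<lambda>x y. B (k + 1 - x) y)" using is_mat_vflip[OF P] by (simp add: vflip_def)
  show "is_mat (m, n, \<lambda>p q. A (m + 1 - p) q)" using is_mat_vflip[OF M] by (simp add: vflip_def)
  show "monotone_triples (\<lambda>x y. B (k + 1 - x) y)" by (rule monotone_triples_vflip[OF P mono])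
  show "\<not> contains (k, l, \<lambda>x y. B (k + 1 - x) y) (m, n, \<lambda>p q. A (m + 1 - p) q)"
    using contains_vflip_iff[OF P M] avoids by (simp add: vflip_def)
  show "B (k + 1 - (k + 1 - a)) b" using Bab ab by simp
  show "z j < d j \<and> d j < z (Suc j) \<and> A (m + 1 - (m + 1 - i)) (d j)" if "Suc j < N" for j
  proof -
    have "i \<le> m" using A_d[OF that] M unfolding is_mat_iff by blast
    then show ?thesis using sep[OF that] by simp
  qed
  fix j assume j: "j < N"
  have im: "i \<le> m" using row[OF j] cuts_le[OF cR[OF j], of a] ab by linarith
  show "cuts l n (C j)" using cC[OF j] .
  show "cuts k m (\<lambda>t. m - R j (k - t))" by (rule cuts_flip[OF cR[OF j]])
  show "C j (b - 1) < z j \<and> z j \<le> C j b" using col[OF j] .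
  have e: "k - (k + 1 - a - 1) = a" "k - (k + 1 - a) = a - 1" using ab by auto
  show "m - R j (k - (k + 1 - a - 1)) < m + 1 - i \<and> m + 1 - i \<le> m - R j (k - (k + 1 - a))"
    unfolding e using row[OF j] im by linarith
  fix x y assume B: "B (k + 1 - x) y" and ne: "(x, y) \<noteq> (k + 1 - a, b)"
  have x: "1 \<le> k + 1 - x" "k + 1 - x \<le> k" using B_bounds[OF B] by auto
  have "(k + 1 - x, y) \<noteq> (a, b)" using ne x by auto
  from hit_vflip[OF hits[OF j B this] cR[OF j] x]
  show "hit (\<lambda>p q. A (m + 1 - p) q) (\<lambda>t. m - R j (k - t)) (C j) x y"
    using x by simp
qed

text \<open>Copy \<open>0\<close> alone supplies the row cuts and all columns up to
  \<open>b\<close>; the rest of the pattern is a piece of row \<open>a\<close> and runs along the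
  ones of row \<open>i\<close>.\<close>

lemma right_part_in_row:
  assumes N: "l + 2 \<le> N" and "\<And>x y. B x y \<Longrightarrow> b < y \<Longrightarrow> x = a"
  shows False
proof (rule glue[of 0 "N - 1" b l "R 0"])
  have "0 < N" using N by simp
  then show "cuts k m (R 0)" "R 0 (a - 1) < i" "i \<le> R 0 a" using cR row by blast+
  fix x y assume "B x y"
  then show "x = a \<and> b \<le> y \<and> y \<le> l \<or> y \<le> b \<and> encloses (R 0) (R 0) x \<or> l \<le> y \<and> encloses (R 0) (R (N - 1)) x"
    using assms(2)[of x y] B_bounds[of x y] unfolding encloses_def by linarith
qed (use N ab in auto)

text \<open>The whole of row \<open>a\<close>, spanning columns \<open>\<alpha>\<close> to
  \<open>\<beta>\<close>, moves to ones of row \<open>i\<close>. Entries off row \<open>a\<close>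
  must not lie inside this span: the left ones come from copy \<open>0\<close>, the right ones from
  copy \<open>N - 1\<close>, and those in column \<open>b\<close> follow the side towards which row
  \<open>a\<close> does not extend (\<open>middle\<close> forbids that it extends both ways). By
  \<open>sides\<close>, if both copies are claimed above row \<open>a\<close>, all these claims
  concern one row, and likewise below; this is what \<open>merge_cuts\<close> needs.\<close>

lemma row_between:
  assumes N: "l + 2 \<le> N"
    and left: "\<And>x y y'. B x y \<Longrightarrow> x \<noteq> a \<Longrightarrow> y < b \<Longrightarrow> B a y' \<Longrightarrow> y \<le> y'"
    and right: "\<And>x y y'. B x y \<Longrightarrow> x \<noteq> a \<Longrightarrow> b < y \<Longrightarrow> B a y' \<Longrightarrow> y' \<le> y"
    and middle: "\<And>x y y'. B x b \<Longrightarrow> x \<noteq> a \<Longrightarrow> B a y \<Longrightarrow> y < b \<Longrightarrow> B a y' \<Longrightarrow> b < y' \<Longrightarrow> False"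
    and sides: "\<And>x y x' y'. B x y \<Longrightarrow> B x' y' \<Longrightarrow> x < a \<and> x' < a \<or> a < x \<and> a < x' \<Longrightarrow>
      y < b \<or> y = b \<and> (\<exists>v>b. B a v) \<Longrightarrow> b < y' \<or> y' = b \<and> (\<exists>v<b. B a v) \<Longrightarrow> x = x'"
  shows False
proof -
  have fin: "finite {y. B a y}" by (rule finite_subset[of _ "{1..l}"]) (use B_bounds in auto)
  define \<alpha> where "\<alpha> = Min {y. B a y}"
  define \<beta> where "\<beta> = Max {y. B a y}"
  have ne: "{y. B a y} \<noteq> {}" using Bab by blast
  have \<alpha>: "B a \<alpha>" "\<And>y. B a y \<Longrightarrow> \<alpha> \<le> y" and \<beta>: "B a \<beta>" "\<And>y. B a y \<Longrightarrow> y \<le> \<beta>"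
    using Min_in[OF fin ne] Max_in[OF fin ne] fin unfolding \<alpha>_def \<beta>_def by auto
  have E: "(\<exists>v>b. B a v) \<longleftrightarrow> \<beta> \<noteq> b" using \<beta> \<beta>(2)[OF Bab] by (metis le_neq_implies_less leD)
  have W: "(\<exists>v<b. B a v) \<longleftrightarrow> \<alpha> \<noteq> b" using \<alpha> \<alpha>(2)[OF Bab] by (metis le_neq_implies_less leD)
  note bb = \<alpha>(2)[OF Bab] \<beta>(2)[OF Bab] B_bounds[OF \<alpha>(1)] B_bounds[OF \<beta>(1)]
  have jN: "0 < N" "N - 1 < N" using N by auto
  have "\<exists>r. cuts k m r \<and> (\<forall>t. r t = R 0 t \<or> r t = R (N - 1) t) \<and>
      (\<forall>x y. B x y \<longrightarrow> Q x \<longrightarrow> y \<le> \<alpha> \<and> encloses r (R 0) x \<or> \<beta> \<le> y \<and> encloses r (R (N - 1)) x)"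
    if Q: "Q = (\<lambda>x. x < a) \<or> Q = (\<lambda>x. a < x)" for Q
  proof -
    let ?S1 = "\<lambda>x. \<exists>y. B x y \<and> Q x \<and> (y < b \<or> y = b \<and> \<beta> \<noteq> b)"
    let ?S2 = "\<lambda>x. \<exists>y. B x y \<and> Q x \<and> (b < y \<or> y = b \<and> \<alpha> \<noteq> b)"
    have S: "x = x'" if "?S1 x" "?S2 x'" for x x'
      using that sides[of x _ x'] Q unfolding E W by metis
    have S1: "1 \<le> x \<and> x \<le> k" if "?S1 x" for x
      using that B_bounds by blast
    from merge_cuts[where ?S1.0 = ?S1 and ?S2.0 = ?S2, OF cR[OF jN(1)] cR[OF jN(2)] S S1]
    obtain r where r: "cuts k m r" "\<forall>t. r t = R 0 t \<or> r t = R (N - 1) t"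
      "\<And>x. ?S1 x \<Longrightarrow> encloses r (R 0) x" "\<And>x. ?S2 x \<Longrightarrow> encloses r (R (N - 1)) x"
      "\<And>x. encloses r (R 0) x \<or> encloses r (R (N - 1)) x"
      by auto
    have "y \<le> \<alpha> \<and> encloses r (R 0) x \<or> \<beta> \<le> y \<and> encloses r (R (N - 1)) x" if xy: "B x y" "Q x" for x y
    proof -
      have xa: "x \<noteq> a" using xy(2) Q by auto
      consider "y < b" | "b < y" | "y = b" "\<beta> \<noteq> b" "\<alpha> = b" | "y = b" "\<beta> = b" "\<alpha> \<noteq> b" | "y = b" "\<beta> = b" "\<alpha> = b"
        using middle[of x \<alpha> \<beta>] \<alpha>(1) \<beta>(1) xy xa bb by (metis linorder_neqE_nat le_neq_implies_less)
      then show ?thesis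
      proof cases
        case 1 then show ?thesis using r(3)[of x] xy left[OF xy(1) xa 1 \<alpha>(1)] by blast
      next
        case 2 then show ?thesis using r(4)[of x] xy right[OF xy(1) xa 2 \<beta>(1)] by blast
      next
        case 3 then show ?thesis using r(3)[of x] xy by blast
      next
        case 4 then show ?thesis using r(4)[of x] xy by blast
      next
        case 5 then show ?thesis using r(5)[of x] by simp
      qed
    qed
    with r(1,2) show ?thesis by blast
  qed
  note merge = this
  obtain u where u: "cuts k m u" "\<And>t. u t = R 0 t \<or> u t = R (N - 1) t"
    "\<And>x y. B x y \<Longrightarrow> x < a \<Longrightarrow> y \<le> \<alpha> \<and> encloses u (R 0) x \<or> \<beta> \<le> y \<and> encloses u (R (N - 1)) x"
    using merge[of "\<lambda>x. x < a"] by auto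
  obtain w where w: "cuts k m w" "\<And>t. w t = R 0 t \<or> w t = R (N - 1) t"
    "\<And>x y. B x y \<Longrightarrow> a < x \<Longrightarrow> y \<le> \<alpha> \<and> encloses w (R 0) x \<or> \<beta> \<le> y \<and> encloses w (R (N - 1)) x"
    using merge[of "\<lambda>x. a < x"] by auto
  \<comment> \<open>The merges above and below row \<open>a\<close> can be joined freely, since row
    \<open>i\<close> lies in row block \<open>a\<close> of both copies.\<close>
  have i: "u (a - 1) < i" "i \<le> w a"
    using u(2)[of "a - 1"] w(2)[of a] row[OF jN(1)] row[OF jN(2)] by auto
  let ?r = "\<lambda>t. if t < a then u t else w t"
  show False
  proof (rule glue[of 0 "N - 1" \<alpha> \<beta> ?r])
    show "cuts k m ?r" by (rule cuts_splice[OF u(1) w(1)]) (use i ab in auto)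
    show "?r (a - 1) < i" "i \<le> ?r a" using i ab by auto
    fix x y assume B: "B x y"
    show "x = a \<and> \<alpha> \<le> y \<and> y \<le> \<beta> \<or> y \<le> \<alpha> \<and> encloses ?r (R 0) x \<or> \<beta> \<le> y \<and> encloses ?r (R (N - 1)) x"
    proof (cases x a rule: linorder_cases)
      case less
      then have "encloses ?r f x \<longleftrightarrow> encloses u f x" for f by (auto simp: encloses_def)
      then show ?thesis using u(3)[OF B less] by blast
    next
      case equal
      then show ?thesis using \<alpha>(2) \<beta>(2) B by blast
    next
      case greater
      then have "encloses ?r f x \<longleftrightarrow> encloses w f x" for f by (auto simp: encloses_def)
      then show ?thesis using w(3)[OF B greater] by blast
    qed
  qed (use bb N in auto)
qed

text \<open>The row cuts come from whichever copy has the lower cut below \<open>a1\<close>; this decides on which side the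
  entries of row \<open>a\<close> have to move to row \<open>i\<close>, which is possible as they share one column there.\<close>

lemma corner_columns:
  assumes N: "l + 2 \<le> N"
    and a1: "a1 < a" "1 \<le> a1"
    and below: "\<And>x y. B x y \<Longrightarrow> a < x \<Longrightarrow> y < b"
    and below': "\<And>x y y'. B x y \<Longrightarrow> a < x \<Longrightarrow> B a y' \<Longrightarrow> y' \<le> b"
    and above: "\<And>x y. B x y \<Longrightarrow> x < a \<Longrightarrow> a1 \<le> x \<and> (x = a1 \<or> y = b)"
    and left: "\<And>x y y'. B x y \<Longrightarrow> y < b \<Longrightarrow> B a y' \<Longrightarrow> y' < b \<Longrightarrow> y = y'"
    and right: "\<And>x y y'. B x y \<Longrightarrow> b < y \<Longrightarrow> B a y' \<Longrightarrow> b < y' \<Longrightarrow> y = y'"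
  shows False
proof -
  let ?M = "N - 1"
  have jN: "0 < N" "?M < N" "0 < ?M" using N by auto
  \<comment> \<open>Row block \<open>a1\<close> starts as high as in either copy; with its end
    chosen by the case distinction below, it encloses that of both.\<close>
  define f where "f = (if R 0 (a1 - 1) \<le> R ?M (a1 - 1) then R 0 else R ?M)"
  have f: "cuts k m f" "f (a1 - 1) \<le> R 0 (a1 - 1)" "f (a1 - 1) \<le> R ?M (a1 - 1)"
    using cR[OF jN(1)] cR[OF jN(2)] by (auto simp: f_def)
  have a1k: "a1 \<le> k" "a1 - 1 < a1" "a1 \<le> a - 1" using a1 ab by auto
  have R1: "R j (a1 - 1) < R j a1" if "j < N" for j
    using cuts_strict[OF cR[OF that] a1k(2,1)] .
  have splice: "cuts k m (\<lambda>t. if t < a1 then f t else g t)"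
    if "cuts k m g" "R j a1 \<le> g a1" "j = 0 \<or> j = ?M" for g j
  proof -
    have "f (a1 - 1) < g a1" using f(2,3) R1[of j] that jN by auto
    then show ?thesis by (rule cuts_splice[OF f(1) that(1) a1(2) a1k(1)])
  qed
  show False
  proof (cases "R ?M a1 \<le> R 0 a1")
    case True
    let ?r = "\<lambda>t. if t < a1 then f t else R 0 t"
    \<comment> \<open>By \<open>right\<close>, the only column right of \<open>b\<close> that row
      \<open>a\<close> can occupy; the default \<open>b\<close> reduces the span to a single
      column.\<close>
    define \<beta> where "\<beta> = (if \<exists>y>b. B a y then SOME y. b < y \<and> B a y else b)"
    have \<beta>: "b < \<beta> \<and> B a \<beta>" if "\<exists>y>b. B a y"
      using someI_ex[of "\<lambda>y. b < y \<and> B a y"] that unfolding \<beta>_def by auto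
    have \<beta>': "\<beta> = b" if "\<not> (\<exists>y>b. B a y)"
      using that unfolding \<beta>_def by (rule if_not_P)
    have \<beta>b: "b \<le> \<beta>" "\<beta> \<le> l" using \<beta> \<beta>' B_bounds[of a \<beta>] ab by (metis le_eq_less_or_eq)+
    have \<beta>r: "\<beta> \<le> y" if "B x y" "b < y" for x y
      using right[OF that, of \<beta>] \<beta> \<beta>' that by (metis le_eq_less_or_eq)
    show False
    proof (rule glue[OF jN(3,2) ab(3) order_refl \<beta>b])
      show "0 + (\<beta> - b) < ?M" using \<beta>b ab N by linarith
      show "cuts k m ?r" by (rule splice[OF cR[OF jN(1)] order_refl]) simp
      show "?r (a - 1) < i" "i \<le> ?r a" using row[OF jN(1)] a1 a1k by auto
      fix x y assume B: "B x y"
      have e0: "encloses ?r (R 0) x" using f(2) above[OF B] a1 unfolding encloses_def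
        by (cases "x = a1") auto
      show "x = a \<and> b \<le> y \<and> y \<le> \<beta> \<or> y \<le> b \<and> encloses ?r (R 0) x \<or> \<beta> \<le> y \<and> encloses ?r (R ?M) x"
      proof (cases "y \<le> b")
        case True then show ?thesis using e0 by blast
      next
        case y: False
        consider "x = a" | "x < a" | "a < x" by linarith
        then show ?thesis
        proof cases
          case 1
          then have "y = \<beta>" using right[of x y \<beta>] \<beta> B y by (metis not_le)
          then show ?thesis using 1 y by simp
        next
          case 2
          then have "x = a1" using above[OF B] y by auto
          then have "encloses ?r (R ?M) x" using f(3) True a1 unfolding encloses_def by auto
          then show ?thesis using \<beta>r[OF B] y by simp
        next
          case 3 then show ?thesis using below[OF B] y by simp
        qed
      qed
    qed
  next
    case False
    \<comment> \<open>Entries below row \<open>a\<close> lie left of \<open>b\<close> and have to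
      come from copy \<open>0\<close>, whereas entries of row \<open>a\<close> right of
      \<open>b\<close> have to come from the last copy. By \<open>below'\<close> these two demands
      never occur together.\<close>
    define g where "g = (if \<exists>y>b. B a y then R ?M else R 0)"
    define r where "r = (\<lambda>t. if t < a1 then f t else if t < a then R ?M t else g t)"
    define \<alpha> where "\<alpha> = (if \<exists>y<b. B a y then SOME y. y < b \<and> B a y else b)"
    have \<alpha>: "\<alpha> < b \<and> B a \<alpha>" if "\<exists>y<b. B a y"
      using someI_ex[of "\<lambda>y. y < b \<and> B a y"] that unfolding \<alpha>_def by auto
    have \<alpha>': "\<alpha> = b" if "\<not> (\<exists>y<b. B a y)"
      using that unfolding \<alpha>_def by (rule if_not_P)
    have \<alpha>b: "1 \<le> \<alpha>" "\<alpha> \<le> b" using \<alpha> \<alpha>' B_bounds[of a \<alpha>] ab by (metis le_eq_less_or_eq)+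
    have \<alpha>l: "y \<le> \<alpha>" if "B x y" "y < b" for x y
      using left[OF that, of \<alpha>] \<alpha> \<alpha>' that by (metis le_eq_less_or_eq)
    have g: "cuts k m g" "i \<le> g a" using cR jN row by (auto simp: g_def)
    have "cuts k m (\<lambda>t. if t < a then R ?M t else g t)"
      by (rule cuts_splice[OF cR[OF jN(2)] g(1) ab(1,2)]) (use row[OF jN(2)] g(2) in linarith)
    then have cr: "cuts k m r"
      unfolding r_def using a1 by (intro splice[of "\<lambda>t. if t < a then R ?M t else g t" ?M]) auto
    have rt: "r t = R ?M t" if "a1 \<le> t" "t < a" for t using that by (simp add: r_def)
    have ra: "r t = g t" if "a \<le> t" for t using that a1 by (simp add: r_def)
    show False
    proof (rule glue[OF jN(3,2) \<alpha>b order_refl ab(4) _ cr])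
      show "0 + (b - \<alpha>) < ?M" using ab N by linarith
      show "r (a - 1) < i" "i \<le> r a" using row[OF jN(2)] rt[of "a - 1"] ra[of a] g(2) a1k a1 by auto
      fix x y assume B: "B x y"
      have ea1: "encloses r (R 0) a1" "encloses r (R ?M) a1"
        using f(2,3) False rt[of a1] a1 unfolding encloses_def by (auto simp: r_def)
      have eM: "encloses r (R ?M) x" if "a1 \<le> x" "x < a"
        using that ea1(2) rt[of x] rt[of "x - 1"] unfolding encloses_def by (cases "x = a1") auto
      show "x = a \<and> \<alpha> \<le> y \<and> y \<le> b \<or> y \<le> \<alpha> \<and> encloses r (R 0) x \<or> b \<le> y \<and> encloses r (R ?M) x"
      proof (cases x a rule: linorder_cases)
        case less
        show ?thesis
        proof (cases "y < b")
          case True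
          then show ?thesis using above[OF B less] ea1 \<alpha>l[OF B] by auto
        next
          case False
          then show ?thesis using above[OF B less] eM less by auto
        qed
      next
        case equal
        consider "y < b" | "y = b" | "b < y" by linarith
        then show ?thesis
        proof cases
          case 1
          then have "y = \<alpha>" using left[of x y \<alpha>] \<alpha> B equal by metis
          then show ?thesis using equal 1 by simp
        next
          case 2 then show ?thesis using equal \<alpha>b by simp
        next
          case 3
          then have "g = R ?M" using B equal by (auto simp: g_def)
          then have "encloses r (R ?M) x"
            using rt[of "a - 1"] ra[of a] a1k a1 equal unfolding encloses_def by simp
          then show ?thesis using 3 by simp
        qed
      next
        case greater
        have "\<not> (\<exists>y>b. B a y)" using below'[OF B greater] by (meson not_le)
        then have "g = R 0" unfolding g_def by (rule if_not_P)
        then have "encloses r (R 0) x" using ra[of x] ra[of "x - 1"] greater unfolding encloses_def by simp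
        then show ?thesis using \<alpha>l[OF B below[OF B greater]] by blast
      qed
    qed
  qed
qed

section \<open>Patterns with two nonempty rows\<close>

text \<open>In a two-row pattern, the upper points left of \<open>b\<close> reach close to the zero: otherwise the lower
  points following them could be placed on the ones \<open>d j\<close>, and so could \<open>(a, b)\<close>.\<close>

lemma two_rows_upper_point:
  assumes rows: "\<And>x y. B x y \<Longrightarrow> x = a1 \<or> x = a" and a1: "a1 < a"
    and bl: "B a1 bl" "bl < b" "\<And>y. B a1 y \<Longrightarrow> y < b \<Longrightarrow> y \<le> bl"
    and x: "b - bl < x" "x < N"
  shows "\<exists>p q. R x (a1 - 1) < p \<and> p \<le> R x a1 \<and> d (x - 1 - (b - bl)) < q \<and> q \<le> C x bl \<and> A p q"
proof -
  have bb: "1 \<le> bl" "1 \<le> a1" using B_bounds[OF bl(1)] by auto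
  obtain p q where pq: "R x (a1 - 1) < p" "p \<le> R x a1" "C x (bl - 1) < q" "q \<le> C x bl" "A p q"
    using hits[OF x(2) bl(1)] a1 unfolding hit_def by blast
  \<comment> \<open>With this choice \<open>d s\<close>, ..., \<open>d (x - 1)\<close> are the last
    \<open>b - bl + 1\<close> separating ones before the zero of copy \<open>x\<close>, one for each
    column from \<open>bl\<close> to \<open>b\<close>.\<close>
  define s where "s = x - 1 - (b - bl)"
  have s: "s + (b - bl) = x - 1" using x(1) by (simp add: s_def)
  have "d s < q"
  proof (rule ccontr)
    assume "\<not> d s < q"
    then have q: "q \<le> d s" by simp
    define c where "c t = (if t < bl then C x t else if t < b then d (s + (t - bl)) else C x t)" for t
    have dd: "d (s + u) < d (s + v)" if "u < v" "v \<le> b - bl" for u v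
      by (rule d_strict) (use that s x in linarith)+
    have dC: "d (s + u) \<le> C x (b - 1)" if "u \<le> b - bl" for u
      by (rule d_le_C) (use that s x in linarith)+
    have Cb: "C x (b - 1) < C x b" using C_strict[OF x(2), of "b - 1" b] ab by simp
    have "cuts l n c" unfolding cuts_def
    proof (intro conjI allI impI)
      show "c 0 = 0" "c l = n"
        using cuts_0[OF cC[OF x(2)]] cuts_top[OF cC[OF x(2)]] bb bl ab by (auto simp: c_def)
      fix t assume t: "t < l"
      consider "Suc t < bl \<or> b \<le> t" | "Suc t = bl" | "bl \<le> t" "Suc t < b" | "Suc t = b" "bl \<le> t"
        by linarith
      then show "c t < c (Suc t)"
      proof cases
        case 1 then show ?thesis using C_strict[OF x(2), of t "Suc t"] t bl by (auto simp: c_def)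
      next
        case 2 then show ?thesis using pq q bl by (auto simp: c_def)
      next
        case 3 then show ?thesis using dd[of "t - bl" "Suc t - bl"] by (simp add: c_def)
      next
        case 4
        then have "t - bl \<le> b - bl" by linarith
        from dC[OF this] show ?thesis using 4 Cb by (simp add: c_def)
      qed
    qed
    have "contains (k, l, B) (m, n, A)"
    proof (rule containsI[OF cR[OF x(2)] \<open>cuts l n c\<close>])
      fix u y assume y: "1 \<le> y" "y \<le> l" and B: "B u y"
      consider "y < bl" | "y = bl" "u = a1" | "bl < y" "y < b" "u = a1" | "bl \<le> y" "y \<le> b" "u = a"
        | "b \<le> y" "(u, y) \<noteq> (a, b)"
        using rows[OF B] a1 by fastforce
      then show "hit A (R x) c u y"
      proof cases
        case 1
        then show ?thesis using bl y
          by (intro hit_mono[OF hits[OF x(2) B]]) (auto simp: c_def)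
      next
        case 2
        then have "c (y - 1) < q" "q \<le> c y" using pq q bb bl by (auto simp: c_def)
        then show ?thesis using pq 2 by (intro hitI[of _ _ p _ _ q]) auto
      next
        case 3 then show ?thesis using bl(3) B by fastforce
      next
        case 4
        have Ai: "A i (d (s + (y - bl)))" by (rule A_d) (use s 4 x in linarith)
        have "d (s + (y - bl)) \<le> c y"
          using dC[of "y - bl"] Cb 4 by (cases "y = b") (auto simp: c_def)
        moreover have "c (y - 1) < d (s + (y - bl))"
        proof (cases "y = bl")
          case True
          then show ?thesis using pq q bb by (simp add: c_def)
        next
          case False
          then have "\<not> y - 1 < bl" "y - 1 < b" "y - 1 - bl < y - bl" "y - bl \<le> b - bl"
            using 4 by linarith+
          then show ?thesis using dd[of "y - 1 - bl" "y - bl"] by (simp only: c_def if_True if_False)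
        qed
        ultimately show ?thesis using row[OF x(2)] Ai 4 by (intro hitI[of _ _ i _ _ "d (s + (y - bl))"]) auto
      next
        case 5
        have "c (y - 1) \<le> C x (y - 1)"
        proof (cases "y = b")
          case True
          have "\<not> b - 1 < bl" "b - 1 < b" using bl by auto
          then show ?thesis using dC[of "b - 1 - bl"] True bl by (simp add: c_def)
        next
          case False
          then have "\<not> y - 1 < bl" "\<not> y - 1 < b" using 5 bl by linarith+
          then show ?thesis by (simp add: c_def)
        qed
        moreover have "C x y \<le> c y" using 5 bl by (auto simp: c_def)
        ultimately show ?thesis using 5 by (intro hit_mono[OF hits[OF x(2) B]]) auto
      qed
    qed
    then show False using avoids by blast
  qed
  then show ?thesis using pq unfolding s_def by blast
qed

text \<open>The copy \<open>j\<close> with the lowest cut below \<open>a1\<close> can use the upper points of all other copies. If many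
  of them lie to its left, spaced by \<open>l + 1\<close>, then they alternate with ones of row \<open>i\<close>, so the whole
  part of the pattern left of \<open>b\<close> fits in front of the one \<open>d (j - 1)\<close>.\<close>

lemma two_rows_maximal:
  assumes rows: "\<And>x y. B x y \<Longrightarrow> x = a1 \<or> x = a" and a1: "a1 < a"
    and left: "B a1 y0" "y0 < b"
    and j: "j < N" "\<And>s. s < N \<Longrightarrow> R s a1 \<le> R j a1"
  shows "j < l * (l + 1)"
proof (rule ccontr)
  assume "\<not> j < l * (l + 1)"
  then have jl: "l * (l + 1) \<le> j" by simp
  have fin: "finite {y. B a1 y \<and> y < b}" by (rule finite_subset[of _ "{..<b}"]) auto
  have ne: "{y. B a1 y \<and> y < b} \<noteq> {}" using left by blast
  define bl where "bl = Max {y. B a1 y \<and> y < b}"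
  have bl: "B a1 bl" "bl < b" "\<And>y. B a1 y \<Longrightarrow> y < b \<Longrightarrow> y \<le> bl"
    using Max_in[OF fin ne] fin unfolding bl_def by auto
  have bb: "1 \<le> bl" "1 \<le> a1" "a1 \<le> k" using B_bounds[OF bl(1)] by auto
  have yj: "y * (l + 1) + l < j" if "y < b" for y
  proof -
    have "y * (l + 1) + (l + 1) \<le> b * (l + 1)" using that
      by (metis Suc_leI add.commute mult_Suc mult_le_mono1)
    also have "\<dots> \<le> l * (l + 1)" using ab by (intro mult_le_mono1) simp
    finally show ?thesis using jl by linarith
  qed
  \<comment> \<open>The upper point of copy \<open>y * (l + 1)\<close> lies beyond a separating one
    that is only \<open>b - bl + 1 \<le> l\<close> indices back. Steps of \<open>l + 1\<close>
    therefore place it after \<open>g (y - 1)\<close>, and it does not pass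
    \<open>g y\<close>.\<close>
  define g where "g y = d (y * (l + 1))" for y
  have gg: "g y < g y'" if "y < y'" "y' < b" for y y'
    unfolding g_def
  proof (rule d_strict)
    show "y * (l + 1) < y' * (l + 1)" using that(1) by (intro mult_strict_right_mono) auto
    show "Suc (y' * (l + 1)) < N" using yj[OF that(2)] ab j(1) by linarith
  qed
  have gj: "g y < d (j - 1)" if "y < b" for y
    unfolding g_def by (rule d_strict) (use yj[OF that] j(1) ab in linarith)+
  have gA: "A i (g y)" if "y < b" for y
    unfolding g_def by (rule A_d) (use yj[OF that] j(1) ab in linarith)
  have dj: "d (j - 1) \<le> C j (b - 1)" "A i (d (j - 1))"
    using d_le_C[of "j - 1" j] A_d[of "j - 1"] yj[of 0] ab j(1) by auto
  have Cb: "C j (b - 1) < C j b" using C_strict[OF j(1), of "b - 1" b] ab by simp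
  \<comment> \<open>For \<open>y = 1\<close> the preceding cut will be \<open>0\<close> rather than
    \<open>g 0\<close>, so only \<open>0 < q\<close> is needed.\<close>
  have upper: "\<exists>s p q. s < N \<and> R s (a1 - 1) < p \<and> p \<le> R s a1 \<and> (y = 1 \<or> g (y - 1) < q) \<and> 0 < q \<and> q \<le> g y \<and> A p q"
    if y: "1 \<le> y" "y < b" for y
  proof -
    let ?x = "y * (l + 1)"
    have step: "?x = (y - 1) * (l + 1) + (l + 1)" using y by (metis Suc_diff_1 add.commute mult_Suc less_eq_Suc_le One_nat_def)
    have x: "b - bl < ?x" "?x < N" "Suc ?x < N" using step yj[OF y(2)] j(1) ab bb by linarith+
    have "\<exists>p q. R ?x (a1 - 1) < p \<and> p \<le> R ?x a1 \<and> d (?x - 1 - (b - bl)) < q \<and> q \<le> C ?x bl \<and> A p q"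
      by (rule two_rows_upper_point[of a1 bl ?x]) (fact rows a1 bl x)+
    then obtain p q where pq: "R ?x (a1 - 1) < p" "p \<le> R ?x a1" "d (?x - 1 - (b - bl)) < q" "q \<le> C ?x bl" "A p q"
      by blast
    have "g (y - 1) \<le> d (?x - 1 - (b - bl))" unfolding g_def
      by (rule d_mono) (use step bl ab bb x in linarith)+
    moreover have "q \<le> g y" unfolding g_def
      using pq(4) C_mono[OF x(2), of bl b] C_less_d[OF order_refl x(3)] bl ab by linarith
    ultimately show ?thesis using pq x(2) by (intro exI[of _ ?x] exI[of _ p] exI[of _ q]) auto
  qed
  \<comment> \<open>Starting as in copy \<open>w\<close> and ending as in copy \<open>j\<close>, row
    block \<open>a1\<close> encloses row block \<open>a1\<close> of every copy, so upper points of
    different copies can be combined.\<close>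
  obtain w where w: "w < N" "\<And>s. s < N \<Longrightarrow> R w (a1 - 1) \<le> R s (a1 - 1)"
  proof -
    let ?w = "arg_min_on (\<lambda>s. R s (a1 - 1)) {..<N}"
    have "finite {..<N}" "{..<N} \<noteq> {}" using j(1) by auto
    then show ?thesis using that[of ?w] arg_min_if_finite[of "{..<N}" "\<lambda>s. R s (a1 - 1)"]
      by (meson lessThan_iff not_le)
  qed
  define r where "r t = (if t < a1 then R w t else R j t)" for t
  have "R w (a1 - 1) < R j a1"
    using w(2)[OF j(1)] cuts_strict[OF cR[OF j(1)], of "a1 - 1" a1] bb by linarith
  then have cr: "cuts k m r" unfolding r_def by (rule cuts_splice[OF cR[OF w(1)] cR[OF j(1)] bb(2,3)])
  have er: "encloses r (R j) x" if "x = a1 \<or> x = a" for x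
    using that w(2)[OF j(1)] a1 bb unfolding encloses_def by (auto simp: r_def)
  define c where "c t = (if t = 0 then 0 else if t < b then g t else C j t)" for t
  have cC': "cuts l n c" unfolding cuts_def
  proof (intro conjI allI impI)
    show "c 0 = 0" "c l = n" using cuts_top[OF cC[OF j(1)]] ab by (auto simp: c_def)
    fix t assume t: "t < l"
    consider "t = 0" | "t \<noteq> 0" "Suc t < b" | "t \<noteq> 0" "Suc t = b" | "b \<le> t" by linarith
    then show "c t < c (Suc t)"
    proof cases
      case 1
      then show ?thesis using upper[of 1] bl bb by (auto simp: c_def)
    next
      case 2 then show ?thesis using gg[of t "Suc t"] by (simp add: c_def)
    next
      case 3 then show ?thesis using gj[of t] dj Cb by (simp add: c_def)
    next
      case 4 then show ?thesis using C_strict[OF j(1), of t "Suc t"] t ab by (simp add: c_def)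
    qed
  qed
  have "contains (k, l, B) (m, n, A)"
  proof (rule containsI[OF cr cC'])
    fix x y assume y: "1 \<le> y" "y \<le> l" and B: "B x y"
    have cy: "c (y - 1) \<le> C j (y - 1)" "C j y \<le> c y" if "b \<le> y"
    proof -
      show "C j y \<le> c y" using that ab by (simp add: c_def)
      show "c (y - 1) \<le> C j (y - 1)"
      proof (cases "y = b")
        case True
        then show ?thesis using gj[of "b - 1"] dj(1) ab by (simp add: c_def)
      next
        case False
        then have "\<not> y - 1 < b" using that by linarith
        then show ?thesis by (simp add: c_def)
      qed
    qed
    consider "y < b" "x = a1" | "y < b" "x = a" | "x = a" "y = b" | "b \<le> y" "(x, y) \<noteq> (a, b)"
      using rows[OF B] by fastforce
    then show "hit A r c x y"
    proof cases
      case 1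
      obtain s p q where *: "s < N" "R s (a1 - 1) < p" "p \<le> R s a1" "y = 1 \<or> g (y - 1) < q" "0 < q" "q \<le> g y" "A p q"
        using upper[OF y(1) 1(1)] by blast
      have "c (y - 1) < q" "q \<le> c y" using * 1 y by (auto simp: c_def)
      moreover have "r (x - 1) < p" "p \<le> r x"
        using * w(2)[OF *(1)] j(2)[OF *(1)] 1 bb by (auto simp: r_def)
      ultimately show ?thesis using * by (intro hitI[of _ _ p _ _ q])
    next
      case 2
      have "c (y - 1) < g y" using 2 y gg[of "y - 1" y] gg[of 0 y] by (auto simp: c_def)
      then show ?thesis using 2 y row[OF j(1)] gA[OF 2(1)] a1
        by (intro hitI[of _ _ i _ _ "g y"]) (auto simp: r_def c_def)
    next
      case 3
      have "c (b - 1) < d (j - 1)" using gj[of "b - 1"] bl bb by (auto simp: c_def)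
      moreover have "d (j - 1) \<le> c b" using dj Cb ab by (auto simp: c_def)
      ultimately show ?thesis using 3 row[OF j(1)] dj a1
        by (intro hitI[of _ _ i _ _ "d (j - 1)"]) (auto simp: r_def)
    next
      case 4
      then show ?thesis using hit_mono[OF hits[OF j(1) B 4(2)]] er[of x] rows[OF B] cy
        unfolding encloses_def by blast
    qed
  qed
  then show False using avoids by blast
qed

text \<open>For the copy \<open>j\<close> whose row block \<open>a1\<close> ends lowest, fewer than
  \<open>l * (l + 1)\<close> copies precede it and, by reflection, fewer than that follow
  it.\<close>

lemma two_rows:
  assumes N: "2 * (l * (l + 1)) \<le> N" "0 < N"
    and rows: "\<And>x y. B x y \<Longrightarrow> x = a1 \<or> x = a" and a1: "a1 < a"
    and left: "B a1 y0" "y0 < b" and right: "B a1 y1" "b < y1"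
  shows False
proof -
  obtain j where j: "j < N" "\<And>s. s < N \<Longrightarrow> R s a1 \<le> R j a1"
  proof -
    have fin: "finite ((\<lambda>s. R s a1) ` {..<N})" "(\<lambda>s. R s a1) ` {..<N} \<noteq> {}" using N by auto
    obtain j where "j < N" "R j a1 = Max ((\<lambda>s. R s a1) ` {..<N})" using Max_in[OF fin] by auto
    then show ?thesis using that[of j] Max_ge[OF fin(1)] by auto
  qed
  have 1: "j < l * (l + 1)" by (rule two_rows_maximal[OF rows a1 left j])
  interpret h: blocked_zeros k l "\<lambda>x y. B x (l + 1 - y)" m n "\<lambda>p q. A p (n + 1 - q)" a "l + 1 - b" i N
    "\<lambda>j. n + 1 - z (N - 1 - j)" "\<lambda>j. n + 1 - d (N - 2 - j)" "\<lambda>j. R (N - 1 - j)" "\<lambda>j t. n - C (N - 1 - j) (l - t)"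
    by (rule hflipped)
  have y1: "l + 1 - (l + 1 - y1) = y1" "l + 1 - y1 < l + 1 - b" using B_bounds[OF right(1)] right(2) by auto
  have "N - 1 - j < l * (l + 1)"
  proof (rule h.two_rows_maximal[of a1 "l + 1 - y1"])
    show "B a1 (l + 1 - (l + 1 - y1))" unfolding y1 by (rule right(1))
    show "N - 1 - j < N" using N by simp
    show "R (N - 1 - s) a1 \<le> R (N - 1 - (N - 1 - j)) a1" if "s < N" for s
    proof -
      have "N - 1 - (N - 1 - j) = j" "N - 1 - s < N" using j(1) that by auto
      then show ?thesis using j(2) by simp
    qed
  qed (use rows a1 y1 in auto)
  with 1 N show False by linarith
qed

subsection \<open>Case analysis on the quadrants around the blocked entry\<close>

lemma left_part_in_row:
  assumes "l + 2 \<le> N" and "\<And>x y. B x y \<Longrightarrow> y < b \<Longrightarrow> x = a"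
  shows False
proof -
  interpret h: blocked_zeros k l "\<lambda>x y. B x (l + 1 - y)" m n "\<lambda>p q. A p (n + 1 - q)" a "l + 1 - b" i N
    "\<lambda>j. n + 1 - z (N - 1 - j)" "\<lambda>j. n + 1 - d (N - 2 - j)" "\<lambda>j. R (N - 1 - j)" "\<lambda>j t. n - C (N - 1 - j) (l - t)"
    by (rule hflipped)
  show False
  proof (rule h.right_part_in_row[OF assms(1)])
    fix x y assume B: "B x (l + 1 - y)" and y: "l + 1 - b < y"
    show "x = a" by (rule assms(2)[OF B]) (use y ab in linarith)
  qed
qed

text \<open>Otherwise \<open>(a, b)\<close> completes a triple in which it is first or last by row
  but in the middle by column.\<close>

lemma same_row:
  assumes "B x y" "B x' y'" "x < a \<and> x' < a \<or> a < x \<and> a < x'" "y < b" "b < y'"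
  shows "x = x'"
proof (rule ccontr)
  assume "x \<noteq> x'"
  then consider "x < x'" "x' < a" | "x' < x" "x < a" | "a < x" "x < x'" | "a < x'" "x' < x"
    using assms(3) by linarith
  then show False
  proof cases
    case 1 from triple[OF assms(1,2) Bab 1] assms(4,5) show False by linarith
  next
    case 2 from triple[OF assms(2,1) Bab 2] assms(4,5) show False by linarith
  next
    case 3 from triple[OF Bab assms(1,2) 3] assms(4,5) show False by linarith
  next
    case 4 from triple[OF Bab assms(2,1) 4] assms(4,5) show False by linarith
  qed
qed

text \<open>Here \<open>(a, b)\<close> is in the middle by row but extreme by column.\<close>

lemma same_column:
  assumes "B x y" "B x' y'" "x < a" "a < x'" "y < b \<and> y' < b \<or> b < y \<and> b < y'"
  shows "y = y'"
  using triple[OF assms(1) Bab assms(2) assms(3,4)] assms(5) by linarith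

lemma alone_in_row:
  assumes "l + 2 \<le> N" and "\<And>y. B a y \<Longrightarrow> y = b"
  shows False
proof (rule row_between[OF assms(1)])
  fix x y x' y'
  assume B: "B x y" "B x' y'" "x < a \<and> x' < a \<or> a < x \<and> a < x'"
    and "y < b \<or> y = b \<and> (\<exists>v>b. B a v)" "b < y' \<or> y' = b \<and> (\<exists>v<b. B a v)"
  then have "y < b" "b < y'" using assms(2) by blast+
  then show "x = x'" by (rule same_row[OF B])
qed (use assms(2) in fastforce)+

text \<open>Triples with the entry of the opposite quadrant keep row \<open>a\<close> between the
  upper left and the lower right entries. An entry of column \<open>b\<close> above row
  \<open>a\<close> also excludes entries of row \<open>a\<close> left of \<open>b\<close>, and one
  below excludes those right of \<open>b\<close>; so no side of row \<open>a\<close> is claimed by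
  both copies.\<close>

lemma opposite_quadrants:
  assumes N: "l + 2 \<le> N"
    and nw: "B x1 y1" "x1 < a" "y1 < b" and se: "B x2 y2" "a < x2" "b < y2"
    and ne: "\<And>x y. B x y \<Longrightarrow> x < a \<Longrightarrow> b < y \<Longrightarrow> False"
    and sw: "\<And>x y. B x y \<Longrightarrow> a < x \<Longrightarrow> y < b \<Longrightarrow> False"
  shows False
proof (rule row_between[OF N])
  fix x y y' assume B: "B x y" "x \<noteq> a" "y < b" "B a y'"
  then have x: "x < a" using sw[OF B(1)] by fastforce
  show "y \<le> y'" using triple[OF B(1,4) se(1) x se(2)] B(3) se(3) by linarith
next
  fix x y y' assume B: "B x y" "x \<noteq> a" "b < y" "B a y'"
  then have x: "a < x" using ne[OF B(1)] by fastforce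
  show "y' \<le> y" using triple[OF nw(1) B(4,1) nw(2) x] B(3) nw(3) by linarith
next
  have N: "b \<le> v" if "B x b" "x < a" "B a v" for x v
    using triple[OF that(1,3) se(1) that(2) se(2)] se(3) by linarith
  have S: "v \<le> b" if "B x b" "a < x" "B a v" for x v
    using triple[OF nw(1) that(3,1) nw(2) that(2)] nw(3) by linarith
  show False if "B x b" "x \<noteq> a" "B a y" "y < b" "B a y'" "b < y'" for x y y'
    using N[OF that(1) _ that(3)] S[OF that(1) _ that(5)] that by linarith
  fix x y x' y'
  assume B: "B x y" "B x' y'" "x < a \<and> x' < a \<or> a < x \<and> a < x'"
    and y: "y < b \<or> y = b \<and> (\<exists>v>b. B a v)" "b < y' \<or> y' = b \<and> (\<exists>v<b. B a v)"
  from B(3) show "x = x'"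
  proof
    assume *: "x < a \<and> x' < a"
    then have "y' = b" "\<exists>v<b. B a v" using ne[OF B(2)] y by auto
    then show ?thesis using N B(2) * by (meson leD)
  next
    assume *: "a < x \<and> a < x'"
    then have "y = b" "\<exists>v>b. B a v" using sw[OF B(1)] y by auto
    then show ?thesis using S B(1) * by (meson leD)
  qed
qed

text \<open>A second entry of row \<open>a\<close> excludes everything below that row, and above it
  all entries outside column \<open>b\<close> lie in row \<open>x1\<close>. If column
  \<open>b\<close> has an entry strictly between rows \<open>x1\<close> and \<open>a\<close>, then
  any entry of row \<open>a\<close> left of \<open>b\<close> shares its column with all entries left
  of \<open>b\<close>, and likewise on the right: the situation of \<open>corner_columns\<close>.
  Otherwise only the rows \<open>x1\<close> and \<open>a\<close> are nonempty.\<close>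

lemma upper_quadrants:
  assumes N: "l + 2 \<le> N" "2 * (l * (l + 1)) \<le> N"
    and nw: "B x1 y1" "x1 < a" "y1 < b" and ne: "B x2 y2" "x2 < a" "b < y2"
    and se: "\<And>x y. B x y \<Longrightarrow> a < x \<Longrightarrow> b < y \<Longrightarrow> False"
    and sw: "\<And>x y. B x y \<Longrightarrow> a < x \<Longrightarrow> y < b \<Longrightarrow> False"
  shows False
proof (cases "\<forall>y. B a y \<longrightarrow> y = b")
  case True
  then show False using alone_in_row[OF N(1)] by blast
next
  case False
  then obtain v where v: "B a v" "v \<noteq> b" by blast
  have x12: "x2 = x1" using same_row[OF nw(1) ne(1)] nw ne by auto
  have low: "x \<le> a" if B: "B x y" for x y
  proof (rule ccontr)
    assume "\<not> x \<le> a"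
    then have x: "a < x" by simp
    then have "y = b" using se[OF B] sw[OF B] by fastforce
    then show False
      using triple[OF nw(1) v(1) B nw(2) x] triple[OF ne(1) v(1) B ne(2) x] nw(3) ne(3) v(2) by linarith
  qed
  have high: "x1 \<le> x \<and> (x = x1 \<or> y = b)" if B: "B x y" and x: "x < a" for x y
  proof (cases y b rule: linorder_cases)
    case less then show ?thesis using same_row[OF B ne(1)] x ne x12 by auto
  next
    case greater then show ?thesis using same_row[OF nw(1) B] x nw by auto
  next
    case equal
    have "\<not> x < x1"
    proof
      assume xx: "x < x1"
      from v(2) consider "v < b" | "b < v" by linarith
      then show False
      proof cases
        case 1 then show False using triple[OF B ne(1) v(1) _ ne(2)] xx x12 equal ne(3) by auto
      next
        case 2 then show False using triple[OF B nw(1) v(1) _ nw(2)] xx equal nw(3) by auto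
      qed
    qed
    then show ?thesis using equal by simp
  qed
  have x1: "1 \<le> x1" using B_bounds[OF nw(1)] by simp
  show False
  proof (cases "\<exists>x. B x b \<and> x1 < x \<and> x < a")
    case True
    then obtain x where x: "B x b" "x1 < x" "x < a" by blast
    show False
    proof (rule corner_columns[OF N(1) nw(2) x1])
      fix u y y' assume B: "B u y" "y < b" "B a y'" "y' < b"
      then have "y1 = y'" using triple[OF nw(1) x(1) B(3) x(2,3)] nw(3) by linarith
      moreover have "y = y1"
      proof (cases "u = a")
        case True
        then show ?thesis using triple[OF nw(1) x(1) B(1)[unfolded True] x(2,3)] nw(3) B(2) by linarith
      next
        case False
        then have "u = x1" using low[OF B(1)] high[OF B(1)] B(2) by fastforce
        then show ?thesis using triple[OF _ x(1) B(3) x(2,3)] B \<open>y1 = y'\<close> by (metis less_asym' less_irrefl)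
      qed
      ultimately show "y = y'" by simp
    next
      fix u y y' assume B: "B u y" "b < y" "B a y'" "b < y'"
      have ne': "B x1 y2" using ne(1) x12 by simp
      have "y2 = y'" using triple[OF ne' x(1) B(3) x(2,3)] ne(3) B by linarith
      moreover have "y = y2"
      proof (cases "u = a")
        case True
        then show ?thesis using triple[OF ne' x(1) B(1)[unfolded True] x(2,3)] ne(3) B(2) by linarith
      next
        case False
        then have "u = x1" using low[OF B(1)] high[OF B(1)] B(2) by fastforce
        then show ?thesis using triple[OF _ x(1) B(3) x(2,3)] B \<open>y2 = y'\<close> by (metis less_asym' less_irrefl)
      qed
      ultimately show "y = y'" by simp
    qed (use low high in \<open>fastforce+\<close>)
  next
    case False
    have "x = x1 \<or> x = a" if "B x y" for x y
      using low[OF that] high[OF that] False that by (metis le_neq_implies_less)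
    moreover have "B x1 y2" using ne(1) x12 by simp
    ultimately show False using two_rows[of x1 y1 y2] N nw ne(3) by auto
  qed
qed

text \<open>A second entry of row \<open>a\<close> forces everything below that row into column
  \<open>y1\<close>, and decreasing triples keep row \<open>a\<close> between \<open>y1\<close> and
  the upper right entries. Only an entry of column \<open>b\<close> strictly between rows
  \<open>x1\<close> and \<open>a\<close> spoils the merge, as it and row \<open>x1\<close> can be
  claimed by different copies; but then row \<open>a\<close> lies in the columns \<open>y1\<close>
  and \<open>b\<close>, and \<open>corner_columns\<close> applies.\<close>

lemma three_quadrants:
  assumes N: "l + 2 \<le> N"
    and nw: "B x1 y1" "x1 < a" "y1 < b" and ne: "B x2 y2" "x2 < a" "b < y2"
    and sw: "B x3 y3" "a < x3" "y3 < b"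
    and se: "\<And>x y. B x y \<Longrightarrow> a < x \<Longrightarrow> b < y \<Longrightarrow> False"
  shows False
proof (cases "\<forall>y. B a y \<longrightarrow> y = b")
  case True
  then show False using alone_in_row[OF N(1)] by blast
next
  case False
  then obtain v where v: "B a v" "v \<noteq> b" by blast
  have x12: "x2 = x1" using same_row[OF nw(1) ne(1)] nw ne by auto
  have y31: "y3 = y1" using same_column[OF nw(1) sw(1)] nw sw by auto
  have ne1: "B x1 y2" and sw1: "B x3 y1" using ne(1) sw(1) x12 y31 by auto
  have below: "y = y1" if B: "B x y" and x: "a < x" for x y
  proof (cases y b rule: linorder_cases)
    case less then show ?thesis using same_column[OF nw(1) B nw(2) x] nw by auto
  next
    case greater then show ?thesis using se[OF B x] by simp
  next
    case equal
    then show ?thesis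
      using triple[OF nw(1) v(1) B nw(2) x] triple[OF ne(1) v(1) B ne(2) x] nw(3) ne(3) v(2) by linarith
  qed
  have N_right: "\<not> b < w" if "B x b" "x < a" "B a w" for x w
    using triple[OF that(1,3) sw1 that(2) sw(2)] nw(3) by linarith
  have high: "x1 \<le> x \<and> (x = x1 \<or> y = b) \<and> (y < b \<longrightarrow> y = y1)" if B: "B x y" and x: "x < a" for x y
  proof (cases y b rule: linorder_cases)
    case less
    then show ?thesis
      using same_row[OF B ne(1)] x ne x12 same_column[OF B sw1 x sw(2)] nw(3) by auto
  next
    case greater then show ?thesis using same_row[OF nw(1) B] x nw by auto
  next
    case equal
    have "\<not> x < x1"
    proof
      assume xx: "x < x1"
      have "x1 < x3" using nw(2) sw(2) by simp
      then show False using triple[OF B ne1 sw1 xx] equal ne(3) nw(3) by linarith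
    qed
    then show ?thesis using equal by simp
  qed
  have W: "y1 \<le> w" if "B a w" for w
    using triple[OF ne1 that sw1 nw(2) sw(2)] nw(3) ne(3) by linarith
  have E: "w \<le> y" if "B a w" "B x y" "x < a" "b < y" for w x y
    using triple[OF that(2,1) sw1 that(3) sw(2)] that(4) nw(3) by linarith
  show False
  proof (cases "\<exists>x. B x b \<and> x1 < x \<and> x < a")
    case False
    show False
    proof (rule row_between[OF N])
      fix x y y' assume B: "B x y" "x \<noteq> a" "y < b" "B a y'"
      then have "y = y1" using below[OF B(1)] high[OF B(1)] by linarith
      then show "y \<le> y'" using W B by simp
    next
      fix x y y' assume B: "B x y" "x \<noteq> a" "b < y" "B a y'"
      then show "y' \<le> y" using E[OF B(4,1)] se[OF B(1)] by (metis linorder_neqE_nat)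
    next
      fix x y y' assume B: "B x b" "x \<noteq> a" "B a y" "y < b" "B a y'" "b < y'"
      then show False using N_right[OF B(1) _ B(5)] below[OF B(1)] nw(3) by linarith
    next
      fix x y x' y'
      assume B: "B x y" "B x' y'" "x < a \<and> x' < a \<or> a < x \<and> a < x'"
        and y: "y < b \<or> y = b \<and> (\<exists>v>b. B a v)" "b < y' \<or> y' = b \<and> (\<exists>v<b. B a v)"
      from B(3) show "x = x'"
      proof
        assume "x < a \<and> x' < a"
        then show ?thesis using high[OF B(1)] high[OF B(2)] False B by (metis le_neq_implies_less)
      next
        assume "a < x \<and> a < x'"
        then show ?thesis using below[OF B(2)] y(2) nw(3) by linarith
      qed
    qed
  next
    case True
    then obtain x where x: "B x b" "x1 < x" "x < a" by blast
    have row: "w \<le> b \<and> (w < b \<longrightarrow> w = y1)" if w: "B a w" for w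
      using N_right[OF x(1,3) w] triple[OF nw(1) x(1) w x(2,3)] nw(3) by linarith
    have x1: "1 \<le> x1" using B_bounds[OF nw(1)] by simp
    show False
    proof (rule corner_columns[OF N nw(2) x1])
      show "y < b" if "B u y" "a < u" for u y using below[OF that] nw(3) by simp
      show "y' \<le> b" if "B u y" "a < u" "B a y'" for u y y' using row[OF that(3)] by simp
      show "x1 \<le> u \<and> (u = x1 \<or> y = b)" if "B u y" "u < a" for u y using high[OF that] by simp
      show "y = y'" if "B u y" "y < b" "B a y'" "y' < b" for u y y'
        using that row[OF that(3)] row[of y] below[OF that(1)] high[OF that(1)]
        by (metis linorder_neqE_nat)
      show "y = y'" if "B u y" "b < y" "B a y'" "b < y'" for u y y'
        using row[OF that(3)] that(4) by simp
    qed
  qed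
qed

text \<open>Off row \<open>a\<close>, all entries left of \<open>b\<close> share column
  \<open>y1\<close> and all entries right of \<open>b\<close> share column \<open>y2\<close>, while
  row \<open>a\<close> stays between these columns. A second entry of row \<open>a\<close> clears
  the rest of column \<open>b\<close>.\<close>

lemma four_quadrants:
  assumes N: "l + 2 \<le> N"
    and nw: "B x1 y1" "x1 < a" "y1 < b" and ne: "B x2 y2" "x2 < a" "b < y2"
    and sw: "B x3 y3" "a < x3" "y3 < b" and se: "B x4 y4" "a < x4" "b < y4"
  shows False
proof (cases "\<forall>y. B a y \<longrightarrow> y = b")
  case True
  then show False using alone_in_row[OF N(1)] by blast
next
  case False
  then obtain v where v: "B a v" "v \<noteq> b" by blast
  have no_b: "x = a" if B: "B x b" for x
  proof (rule ccontr)
    assume "x \<noteq> a"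
    then consider "x < a" | "a < x" by linarith
    then show False
    proof cases
      case 1
      show False using triple[OF B v(1) sw(1) 1 sw(2)] triple[OF B v(1) se(1) 1 se(2)] sw(3) se(3) v(2)
        by linarith
    next
      case 2
      show False using triple[OF nw(1) v(1) B nw(2) 2] triple[OF ne(1) v(1) B ne(2) 2] nw(3) ne(3) v(2)
        by linarith
    qed
  qed
  show False
  proof (rule row_between[OF N])
    fix x y y' assume B: "B x y" "x \<noteq> a" "y < b" "B a y'"
    have "y = y1"
      using same_column[OF nw(1) sw(1) nw(2) sw(2)] same_column[OF B(1) sw(1) _ sw(2)]
        same_column[OF nw(1) B(1) nw(2)] B nw(3) sw(3) by (metis linorder_neqE_nat)
    moreover have "y1 \<le> y'"
      using triple[OF nw(1) B(4) se(1) nw(2) se(2)] nw(3) se(3) by linarith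
    ultimately show "y \<le> y'" by simp
  next
    fix x y y' assume B: "B x y" "x \<noteq> a" "b < y" "B a y'"
    have "y = y2"
      using same_column[OF ne(1) se(1) ne(2) se(2)] same_column[OF B(1) se(1) _ se(2)]
        same_column[OF ne(1) B(1) ne(2)] B ne(3) se(3) by (metis linorder_neqE_nat)
    moreover have "y' \<le> y2"
      using triple[OF ne(1) B(4) sw(1) ne(2) sw(2)] ne(3) sw(3) by linarith
    ultimately show "y' \<le> y" by simp
  next
    fix x y x' y'
    assume B: "B x y" "B x' y'" "x < a \<and> x' < a \<or> a < x \<and> a < x'"
      and "y < b \<or> y = b \<and> (\<exists>v>b. B a v)" "b < y' \<or> y' = b \<and> (\<exists>v<b. B a v)"
    then have "y < b" "b < y'" using no_b by blast+
    then show "x = x'" by (rule same_row[OF B])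
  qed (use no_b in blast)
qed

lemma upper_sides:
  assumes N: "l + 2 \<le> N" "2 * (l * (l + 1)) \<le> N"
    and nw: "B x1 y1" "x1 < a" "y1 < b" and ne: "B x2 y2" "x2 < a" "b < y2"
  shows False
proof (cases "\<exists>x y. B x y \<and> a < x \<and> y < b")
  case True
  then obtain x3 y3 where sw: "B x3 y3" "a < x3" "y3 < b" by blast
  then show False using three_quadrants[OF N(1) nw ne sw] four_quadrants[OF N(1) nw ne sw] by blast
next
  case sw: False
  show False
  proof (cases "\<exists>x y. B x y \<and> a < x \<and> b < y")
    case False
    then show False using upper_quadrants[OF N nw ne] sw by blast
  next
    case True
    then obtain x4 y4 where se: "B x4 y4" "a < x4" "b < y4" by blast
    interpret h: blocked_zeros k l "\<lambda>x y. B x (l + 1 - y)" m n "\<lambda>p q. A p (n + 1 - q)" a "l + 1 - b" i N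
      "\<lambda>j. n + 1 - z (N - 1 - j)" "\<lambda>j. n + 1 - d (N - 2 - j)" "\<lambda>j. R (N - 1 - j)" "\<lambda>j t. n - C (N - 1 - j) (l - t)"
      by (rule hflipped)
    have e: "l + 1 - (l + 1 - y) = y" if "B x y" for x y using B_bounds[OF that] by simp
    show False
    proof (rule h.three_quadrants[OF N(1), of x2 "l + 1 - y2" x1 "l + 1 - y1" x4 "l + 1 - y4"])
      show "B x2 (l + 1 - (l + 1 - y2))" "B x1 (l + 1 - (l + 1 - y1))" "B x4 (l + 1 - (l + 1 - y4))"
        using nw ne se e by simp_all
      show "l + 1 - y2 < l + 1 - b" "l + 1 - b < l + 1 - y1" "l + 1 - y4 < l + 1 - b"
        using nw ne se ab B_bounds[OF nw(1)] B_bounds[OF ne(1)] B_bounds[OF se(1)] by linarith+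
      fix x y assume B: "B x (l + 1 - y)" "a < x" "l + 1 - b < y"
      then have "l + 1 - y < b" using ab by linarith
      then show False using sw B by blast
    qed (fact nw ne se)+
  qed
qed

lemma lower_sides:
  assumes N: "l + 2 \<le> N" "2 * (l * (l + 1)) \<le> N"
    and sw: "B x1 y1" "a < x1" "y1 < b" and se: "B x2 y2" "a < x2" "b < y2"
  shows False
proof -
  interpret v: blocked_zeros k l "\<lambda>x y. B (k + 1 - x) y" m n "\<lambda>p q. A (m + 1 - p) q" "k + 1 - a" b "m + 1 - i" N
    z d "\<lambda>j t. m - R j (k - t)" C
    by (rule vflipped)
  show False
    by (rule v.upper_sides[OF N, of "k + 1 - x1" y1 "k + 1 - x2" y2])
      (use sw se ab B_bounds[OF sw(1)] B_bounds[OF se(1)] in auto)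
qed

lemma diagonal_sides:
  assumes N: "l + 2 \<le> N" "2 * (l * (l + 1)) \<le> N"
    and nw: "B x1 y1" "x1 < a" "y1 < b" and se: "B x2 y2" "a < x2" "b < y2"
  shows False
  using opposite_quadrants[OF N(1) nw se] upper_sides[OF N nw] lower_sides[OF N _ _ _ se] by blast

lemma antidiagonal_sides:
  assumes N: "l + 2 \<le> N" "2 * (l * (l + 1)) \<le> N"
    and ne: "B x1 y1" "x1 < a" "b < y1" and sw: "B x2 y2" "a < x2" "y2 < b"
  shows False
proof -
  interpret h: blocked_zeros k l "\<lambda>x y. B x (l + 1 - y)" m n "\<lambda>p q. A p (n + 1 - q)" a "l + 1 - b" i N
    "\<lambda>j. n + 1 - z (N - 1 - j)" "\<lambda>j. n + 1 - d (N - 2 - j)" "\<lambda>j. R (N - 1 - j)" "\<lambda>j t. n - C (N - 1 - j) (l - t)"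
    by (rule hflipped)
  show False
    by (rule h.diagonal_sides[OF N, of x1 "l + 1 - y1" x2 "l + 1 - y2"])
      (use ne sw ab B_bounds[OF ne(1)] B_bounds[OF sw(1)] in auto)
qed

text \<open>On either side of \<open>b\<close> there is an entry off row \<open>a\<close>, for
  otherwise that side could run along row \<open>i\<close>. Each of the four vertical positions of
  these two entries is excluded. The bound is a sum so as to imply both lower bounds on
  \<open>N\<close>.\<close>

theorem few_blocked_zeros: "N < 2 * (l * (l + 1)) + l + 2"
proof (rule ccontr)
  assume "\<not> ?thesis"
  then have N: "l + 2 \<le> N" "2 * (l * (l + 1)) \<le> N" by linarith+
  obtain x y where r: "B x y" "b < y" "x \<noteq> a" using right_part_in_row[OF N(1)] by blast
  obtain u v where l: "B u v" "v < b" "u \<noteq> a" using left_part_in_row[OF N(1)] by blast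
  from r l consider "x < a" "u < a" | "x < a" "a < u" | "a < x" "u < a" | "a < x" "a < u" by linarith
  then show False
  proof cases
    case 1 show False by (rule upper_sides[OF N l(1) 1(2) l(2) r(1) 1(1) r(2)])
  next
    case 2 show False by (rule antidiagonal_sides[OF N r(1) 2(1) r(2) l(1) 2(2) l(2)])
  next
    case 3 show False by (rule diagonal_sides[OF N l(1) 3(2) l(2) r(1) 3(1) r(2)])
  next
    case 4 show False by (rule lower_sides[OF N l(1) 4(2) l(2) r(1) 4(1) r(2)])
  qed
qed

end

section \<open>From a critical matrix to blocked zeros, and conclusion\<close>

lemma hit_fun_upd:
  assumes "hit (A(i := (A i)(z := True))) r c x y" "\<not> hit A r c x y"
  shows "r (x - 1) < i \<and> i \<le> r x \<and> c (y - 1) < z \<and> z \<le> c y"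
  using assms unfolding hit_def by (metis fun_upd_apply)

lemma cuts_block_unique:
  assumes "cuts k m r" "x \<le> k" "y \<le> k" "r (x - 1) < p" "p \<le> r x" "r (y - 1) < p" "p \<le> r y"
  shows "x = y"
proof (rule ccontr)
  assume "x \<noteq> y"
  then consider "x \<le> y - 1" | "y \<le> x - 1" by linarith
  then show False
    using cuts_mono[OF assms(1), of x "y - 1"] cuts_mono[OF assms(1), of y "x - 1"] assms by cases linarith+
qed

text \<open>The blocks of a copy are disjoint, so the new one serves a single entry of the pattern,
  and all other entries are hit within \<open>A\<close>.\<close>

lemma unique_new_entry:
  assumes "\<not> contains (k, l, B) (m, n, A)" "contains (k, l, B) (m, n, A(i := (A i)(z := True)))"
  shows "\<exists>a b r c. 1 \<le> a \<and> a \<le> k \<and> 1 \<le> b \<and> b \<le> l \<and> B a b \<and> cuts k m r \<and> cuts l n c \<and>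
    r (a - 1) < i \<and> i \<le> r a \<and> c (b - 1) < z \<and> z \<le> c b \<and>
    (\<forall>x y. 1 \<le> x \<longrightarrow> x \<le> k \<longrightarrow> 1 \<le> y \<longrightarrow> y \<le> l \<longrightarrow> B x y \<longrightarrow> (x, y) \<noteq> (a, b) \<longrightarrow> hit A r c x y)"
proof -
  obtain r c where rc: "cuts k m r" "cuts l n c"
    "\<And>x y. 1 \<le> x \<Longrightarrow> x \<le> k \<Longrightarrow> 1 \<le> y \<Longrightarrow> y \<le> l \<Longrightarrow> B x y \<Longrightarrow> hit (A(i := (A i)(z := True))) r c x y"
    using assms(2) unfolding contains_iff by blast
  obtain a b where ab: "1 \<le> a" "a \<le> k" "1 \<le> b" "b \<le> l" "B a b" "\<not> hit A r c a b"
    using containsI[OF rc(1,2)] assms(1) by blast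
  have h: "r (a - 1) < i" "i \<le> r a" "c (b - 1) < z" "z \<le> c b"
    using hit_fun_upd[OF rc(3)[OF ab(1-5)] ab(6)] by auto
  have "hit A r c x y" if xy: "1 \<le> x" "x \<le> k" "1 \<le> y" "y \<le> l" "B x y" "(x, y) \<noteq> (a, b)" for x y
  proof (rule ccontr)
    assume "\<not> hit A r c x y"
    from hit_fun_upd[OF rc(3)[OF xy(1-5)] this]
    have "x = a" "y = b"
      using cuts_block_unique[OF rc(1) xy(2) ab(2) _ _ h(1,2)] cuts_block_unique[OF rc(2) xy(4) ab(4) _ _ h(3,4)]
      by blast+
    then show False using xy(6) by simp
  qed
  with ab(1-5) rc(1,2) h show ?thesis by blast
qed

lemma row_bounded_if_monotone_triples:
  assumes P: "is_mat (k, l, B)" and mono: "monotone_triples B"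
  shows "row_bounded (Av (k, l, B))"
proof -
  define T where "T = 2 * (l * (l + 1)) + l + 2"
  have bound: "row_complexity (m, n, A) i \<le> k * l * T"
    if crit: "critical (Av (k, l, B)) (m, n, A)" and i: "1 \<le> i" "i \<le> m" for m n A i
  proof -
    have M: "is_mat (m, n, A)" "\<not> contains (k, l, B) (m, n, A)"
      using crit unfolding critical_def Av_def by auto
    define Z where "Z = {j \<in> {1..n}. \<not> A i j \<and> (j = 1 \<or> A i (j - 1))}"
    have finZ: "finite Z" by (simp add: Z_def)
    have flip: "contains (k, l, B) (m, n, A(i := (A i)(z := True)))" if "z \<in> Z" for z
    proof -
      have z: "1 \<le> z" "z \<le> n" "\<not> A i z" using that unfolding Z_def by auto
      then have "(m, n, A(i := (A i)(z := True))) \<notin> Av (k, l, B)"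
        using crit i unfolding critical_def by simp
      moreover have "is_mat (m, n, A(i := (A i)(z := True)))"
        using M(1) z i unfolding is_mat_iff by (metis fun_upd_apply)
      ultimately show ?thesis unfolding Av_def by blast
    qed
    define good where "good z a b r c \<longleftrightarrow> 1 \<le> a \<and> a \<le> k \<and> 1 \<le> b \<and> b \<le> l \<and> B a b \<and> cuts k m r \<and> cuts l n c \<and>
      r (a - 1) < i \<and> i \<le> r a \<and> c (b - 1) < z \<and> z \<le> c b \<and>
      (\<forall>x y. 1 \<le> x \<longrightarrow> x \<le> k \<longrightarrow> 1 \<le> y \<longrightarrow> y \<le> l \<longrightarrow> B x y \<longrightarrow> (x, y) \<noteq> (a, b) \<longrightarrow> hit A r c x y)" for z a b r c
    have "\<exists>a b r c. good z a b r c" if "z \<in> Z" for z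
      using unique_new_entry[OF M(2) flip[OF that]] unfolding good_def .
    then obtain ea eb er ec where good: "\<And>z. z \<in> Z \<Longrightarrow> good z (ea z) (eb z) (er z) (ec z)"
      by metis
    let ?E = "{1..k} \<times> {1..l}"
    have fibre: "card {z \<in> Z. (ea z, eb z) = (a, b)} \<le> T" for a b
    proof (rule ccontr)
      let ?S = "{z \<in> Z. (ea z, eb z) = (a, b)}"
      assume "\<not> card ?S \<le> T"
      then have T: "T < card ?S" by simp
      define xs where "xs = sorted_list_of_set ?S"
      have finS: "finite ?S" using finZ by simp
      have xs: "length xs = card ?S" "set xs = ?S" "sorted_wrt (<) xs"
        using finS by (auto simp: xs_def strict_sorted_iff)
      have xsS: "xs ! j \<in> ?S" if "j < card ?S" for j using nth_mem[of j xs] that xs by simp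
      have xsG: "good (xs ! j) a b (er (xs ! j)) (ec (xs ! j))" if "j < card ?S" for j
        using good[of "xs ! j"] xsS[OF that] by auto
      \<comment> \<open>The separating one is the left neighbour of the next chosen run; that run
        starts beyond column 1, so this neighbour exists.\<close>
      have "blocked_zeros k l B m n A a b i (card ?S) (\<lambda>j. xs ! j) (\<lambda>j. xs ! Suc j - 1) (\<lambda>j. er (xs ! j)) (\<lambda>j. ec (xs ! j))"
      proof
        show "B a b" using xsG[of 0] T unfolding good_def by simp
        fix j
        {
          assume j: "Suc j < card ?S"
          have lt: "xs ! j < xs ! Suc j" using sorted_wrt_nth_less[OF xs(3), of j "Suc j"] j xs(1) by simp
          have "xs ! j \<in> Z" "xs ! Suc j \<in> Z" using xsS[of j] xsS[OF j] j by auto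
          then have "1 \<le> xs ! j" "\<not> A i (xs ! j)" "A i (xs ! Suc j - 1)" using lt unfolding Z_def by auto
          moreover from this have "xs ! j \<noteq> xs ! Suc j - 1" by metis
          ultimately show "xs ! j < xs ! Suc j - 1 \<and> xs ! Suc j - 1 < xs ! Suc j \<and> A i (xs ! Suc j - 1)"
            using lt by auto
        }
        assume j: "j < card ?S"
        note G = xsG[OF j, unfolded good_def]
        show "cuts k m (er (xs ! j))" "cuts l n (ec (xs ! j))"
          "er (xs ! j) (a - 1) < i \<and> i \<le> er (xs ! j) a"
          "ec (xs ! j) (b - 1) < xs ! j \<and> xs ! j \<le> ec (xs ! j) b"
          using G by blast+
        fix x y assume "B x y" "(x, y) \<noteq> (a, b)"
        moreover from \<open>B x y\<close> have "1 \<le> x" "x \<le> k" "1 \<le> y" "y \<le> l" using P unfolding is_mat_iff by blast+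
        ultimately show "hit A (er (xs ! j)) (ec (xs ! j)) x y" using G by blast
      qed (fact P M mono)+
      from blocked_zeros.few_blocked_zeros[OF this] T show False unfolding T_def by linarith
    qed
    have "Z = (\<Union>e\<in>?E. {z \<in> Z. (ea z, eb z) = e})"
      using good unfolding good_def by auto
    then have "card Z \<le> (\<Sum>e\<in>?E. card {z \<in> Z. (ea z, eb z) = e})"
      using card_UN_le[of ?E "\<lambda>e. {z \<in> Z. (ea z, eb z) = e}"] by simp
    also have "\<dots> \<le> (\<Sum>e\<in>?E. T)" by (rule sum_mono) (use fibre in auto)
    also have "\<dots> = k * l * T" by simp
    finally show ?thesis by (simp add: row_complexity_def Z_def)
  qed
  show ?thesis unfolding row_bounded_def
  proof (intro exI[of _ "k * l * T"] allI impI ballI)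
    fix M i assume "critical (Av (k, l, B)) M" "i \<in> {1..fst M}"
    then show "row_complexity M i \<le> k * l * T" using bound by (cases M) auto
  qed
qed

theorem theorem3p1:
  assumes "is_mat P"
  shows "row_bounded (Av P) \<longleftrightarrow>
         (\<not> contains Q1 P \<and> \<not> contains Q2 P \<and> \<not> contains Q3 P \<and> \<not> contains Q4 P)"
proof (cases P)
  case (fields k l B)
  show ?thesis
    using assms avoids_Q_iff row_bounded_if_monotone_triples not_row_bounded_if_not_monotone_triples
    unfolding fields by blast
qed

end
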